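(* Let $\sim$ be a $\gamma$-congruence on a GPEA $P$ which satisfies conditions (C4) and (C5$'$). Let $\sim^*$ be the extension of $\sim$ in the $\gamma$-unitization $U$ of $P$. Define $\widetilde{\gamma}:P/{\sim}\to P/{\sim}$ by $\widetilde{\gamma}[a]=[\gamma a]$. Then $\widetilde{\gamma}$ is a unitizing automorphism in $P/{\sim}$, and $U/{\sim^*}$ is the $\widetilde{\gamma}$-unitization of $P/{\sim}$. In particular, if $I$ is a normal Riesz $\gamma$-ideal on $P$ such that $\sim_I$ satisfies (GCR), then the $\widetilde{\gamma}$-unitization of $P/I$ is $U/I$.
   Context: $P$ is a GPEA (partial $\oplus$, constant $0$; partial associativity; conjugation; two-sided cancellation; neutral $0$; positivity), ordered by $a\le b$ iff $a\oplus c=b$ for some $c$; for $a\le b$, $a/b$ is the unique $c$ with $a\oplus c=b$ and $b\backslash a$ the unique $d$ with $d\oplus a=b$. $\gamma$ is a unitizing GPEA-automorphism ($\gamma a\oplus b$ defined iff $b\oplus a$ defined). The $\gamma$-unitization $U=P\cup P^\eta$ ($\eta$ a bijection onto a disjoint set, $1:=\eta0$): sums in $P$ as in $P$; $a+\eta b$ defined iff $a\le b$, equal to $\eta(b\backslash a)$; $\eta a+b$ defined iff $\gamma b\le a$, equal to $\eta(\gamma b/a)$; no sums within $P^\eta$; $U$ is a pseudo effect algebra with $\eta a=a^\sim$, $\gamma a=a^{--}$. A congruence: equivalence relation with (C2) $a\oplus b$, $a_1\oplus b_1$ exist, $a\sim a_1$, $b\sim b_1\Rightarrow a\oplus b\sim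 a_1\oplus b_1$, and (C3) if $a\oplus b$ exists, for any $a_1\sim a$ some $b_1\sim b$ has $a_1\oplus b_1$ existing and for any $b_2\sim b$ some $a_2\sim a$ has $a_2\oplus b_2$ existing. (C4): $a\sim b$ and ($a\oplus a_1\sim b\oplus b_1$ or $a_1\oplus a\sim b_1\oplus b$) imply $a_1\sim b_1$. (C5$'$): $a\sim b\oplus c$ implies $a=a_1\oplus a_2$ with $a_1\sim b$, $a_2\sim c$. $\gamma$-congruence: $a\sim b\Leftrightarrow\gamma a\sim\gamma b$. $\sim^*$: $a\sim^*b$ iff $a\sim b$, $\eta a\sim^*\eta b$ iff $a\sim b$, elements of $P$ and $P^\eta$ never related. On the quotient, $[a]\oplus[b]$ exists iff $a_1\oplus b_1$ exists for some $a_1\sim a$, $b_1\sim b$, and then equals $[a_1\oplus b_1]$. Ideal, normal, $\gamma$-ideal, Riesz ideal as usual: ideal = nonempty down-set closed under existing sums; normal: $a\oplus c=c\oplus b\Rightarrow(a\in I\Leftrightarrow b\in I)$; $\gamma$-ideal: $a\in I\Leftrightarrow\gamma a\in I$; Riesz: (R1) $i\in I$, $i\le a\oplus b\Rightarrow i\le j\oplus k$, $j,k\in I$, $j\le a$, $k\le b$; (R2) $i\in I$, $i\le a$: if $(a\backslash i)\oplus b$ exists then some $j\in I$, $j\le b$, has $a\oplus(j/b)$ existing, and if $b\oplus(i/a)$ exists then some $k\in I$, $k\le b$, has $(b\backslash k)\oplus a$ existing. $a\sim_I b$ iff $a\backslash i=b\backslash j$ for some $i,j\in I$, $i\le a$,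 $j\le b$; $P/I$ and $U/I$ denote the quotients by $\sim_I$ and its extension $\sim_I^*$. (GCR): $a\sim_I b$ implies $i\oplus a=j\oplus b$ for some $i,j\in I$. *)

theory Defs
  imports Main
begin

section \<open>Generalized pseudo effect algebras\<close>

text \<open>
  The partial sum is option-valued: \<open>a \<oplus>\<^bsub>P\<^esub> b = None\<close> means that the sum of \<open>a\<close> and \<open>b\<close> does not
  exist. Values of the sum on arguments outside the carrier are irrelevant and unconstrained.
\<close>

record 'a partial_alg =
  carrier :: "'a set"
  psum :: "'a \<Rightarrow> 'a \<Rightarrow> 'a option"  (infixl \<open>\<oplus>\<index>\<close> 65)
  zero :: 'a  (\<open>\<zero>\<index>\<close>)

record 'a unital_partial_alg = "'a partial_alg" +
  one :: 'a  (\<open>\<one>\<index>\<close>)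

locale gpea =
  fixes P :: "('a, 'm) partial_alg_scheme" (structure)
  assumes zero_closed: "\<zero> \<in> carrier P"
    and psum_closed: "\<lbrakk>a \<in> carrier P; b \<in> carrier P; a \<oplus> b = Some c\<rbrakk> \<Longrightarrow> c \<in> carrier P"
    and psum_assoc: "\<lbrakk>a \<in> carrier P; b \<in> carrier P; c \<in> carrier P\<rbrakk> \<Longrightarrow>
      (\<exists>d. a \<oplus> b = Some d \<and> d \<oplus> c = Some e) \<longleftrightarrow> (\<exists>f. b \<oplus> c = Some f \<and> a \<oplus> f = Some e)"
    and psum_conjugation: "\<lbrakk>a \<in> carrier P; b \<in> carrier P; a \<oplus> b = Some c\<rbrakk> \<Longrightarrow>
      \<exists>d\<in>carrier P. \<exists>e\<in>carrier P. d \<oplus> a = Some c \<and> b \<oplus> e = Some c"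
    and psum_left_cancel: "\<lbrakk>a \<in> carrier P; b \<in> carrier P; c \<in> carrier P;
      a \<oplus> b = Some d; a \<oplus> c = Some d\<rbrakk> \<Longrightarrow> b = c"
    and psum_right_cancel: "\<lbrakk>a \<in> carrier P; b \<in> carrier P; c \<in> carrier P;
      b \<oplus> a = Some d; c \<oplus> a = Some d\<rbrakk> \<Longrightarrow> b = c"
    and psum_zero_right: "a \<in> carrier P \<Longrightarrow> a \<oplus> \<zero> = Some a"
    and psum_zero_left: "a \<in> carrier P \<Longrightarrow> \<zero> \<oplus> a = Some a"
    and psum_positive: "\<lbrakk>a \<in> carrier P; b \<in> carrier P; a \<oplus> b = Some \<zero>\<rbrakk> \<Longrightarrow> a = \<zero> \<and> b = \<zero>"

definition ple :: "('a, 'm) partial_alg_scheme \<Rightarrow> 'a \<Rightarrow> 'a \<Rightarrow> bool"  (infixl \<open>\<preceq>\<index>\<close> 50) where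
  "ple P a b \<longleftrightarrow> (\<exists>c\<in>carrier P. a \<oplus>\<^bsub>P\<^esub> c = Some b)"

text \<open>The difference \<open>a / b\<close>, for \<open>a \<le> b\<close>: the \<open>c\<close> with \<open>a \<oplus> c = b\<close>.\<close>

definition ldiff :: "('a, 'm) partial_alg_scheme \<Rightarrow> 'a \<Rightarrow> 'a \<Rightarrow> 'a" where
  "ldiff P a b = (THE c. c \<in> carrier P \<and> a \<oplus>\<^bsub>P\<^esub> c = Some b)"

text \<open>The difference \<open>b \ a\<close>, for \<open>a \<le> b\<close>: the \<open>d\<close> with \<open>d \<oplus> a = b\<close>.\<close>

definition rdiff :: "('a, 'm) partial_alg_scheme \<Rightarrow> 'a \<Rightarrow> 'a \<Rightarrow> 'a" where
  "rdiff P b a = (THE d. d \<in> carrier P \<and> d \<oplus>\<^bsub>P\<^esub> a = Some b)"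

section \<open>Unitizing automorphisms and the unitization\<close>

text \<open>
  The use of \<^const>\<open>map_option\<close> states both that \<open>\<gamma> a \<oplus> \<gamma> b\<close> exists iff \<open>a \<oplus> b\<close> does, and that
  it then equals \<open>\<gamma> (a \<oplus> b)\<close>.
\<close>

locale unitizing_automorphism = gpea P for P :: "('a, 'm) partial_alg_scheme" (structure) +
  fixes \<gamma> :: "'a \<Rightarrow> 'a"
  assumes aut_bij: "bij_betw \<gamma> (carrier P) (carrier P)"
    and aut_psum: "\<lbrakk>a \<in> carrier P; b \<in> carrier P\<rbrakk> \<Longrightarrow> \<gamma> a \<oplus> \<gamma> b = map_option \<gamma> (a \<oplus> b)"
    and unitizing: "\<lbrakk>a \<in> carrier P; b \<in> carrier P\<rbrakk> \<Longrightarrow> \<gamma> a \<oplus> b \<noteq> None \<longleftrightarrow> b \<oplus> a \<noteq> None"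

text \<open>
  \<open>gamma_unitization P \<gamma> \<eta> U\<close>: \<open>U\<close> is the \<open>\<gamma>\<close>-unitization of \<open>P\<close>, the bijection from \<open>P\<close> onto
  the disjoint set \<open>P\<^sup>\<eta>\<close> being \<open>\<eta>\<close>. The algebra \<open>P\<close> is literally a subset of \<open>U\<close>.
\<close>

locale gamma_unitization = unitizing_automorphism P \<gamma>
  for P :: "('a, 'm) partial_alg_scheme" and \<gamma> :: "'a \<Rightarrow> 'a" +
  fixes \<eta> :: "'a \<Rightarrow> 'a" and U :: "('a, 'n) unital_partial_alg_scheme"
  assumes eta_inj: "inj_on \<eta> (carrier P)"
    and eta_disjoint: "carrier P \<inter> \<eta> ` carrier P = {}"
    and carrier_U: "carrier U = carrier P \<union> \<eta> ` carrier P"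
    and zero_U: "\<zero>\<^bsub>U\<^esub> = \<zero>\<^bsub>P\<^esub>"
    and one_U: "\<one>\<^bsub>U\<^esub> = \<eta> \<zero>\<^bsub>P\<^esub>"
    and psum_U: "\<lbrakk>a \<in> carrier P; b \<in> carrier P\<rbrakk> \<Longrightarrow> a \<oplus>\<^bsub>U\<^esub> b = a \<oplus>\<^bsub>P\<^esub> b"
    and psum_U_eta_right: "\<lbrakk>a \<in> carrier P; b \<in> carrier P\<rbrakk> \<Longrightarrow>
      a \<oplus>\<^bsub>U\<^esub> \<eta> b = (if a \<preceq>\<^bsub>P\<^esub> b then Some (\<eta> (rdiff P b a)) else None)"
    and psum_U_eta_left: "\<lbrakk>a \<in> carrier P; b \<in> carrier P\<rbrakk> \<Longrightarrow>
      \<eta> a \<oplus>\<^bsub>U\<^esub> b = (if \<gamma> b \<preceq>\<^bsub>P\<^esub> a then Some (\<eta> (ldiff P (\<gamma> b) a)) else None)"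
    and psum_U_eta_eta: "\<lbrakk>a \<in> carrier P; b \<in> carrier P\<rbrakk> \<Longrightarrow> \<eta> a \<oplus>\<^bsub>U\<^esub> \<eta> b = None"

section \<open>Congruences and quotients\<close>

definition congruence :: "('a, 'm) partial_alg_scheme \<Rightarrow> ('a \<times> 'a) set \<Rightarrow> bool" where
  "congruence P r \<longleftrightarrow> equiv (carrier P) r \<and>
    (\<forall>a a' b b' c c'. (a, a') \<in> r \<longrightarrow> (b, b') \<in> r \<longrightarrow>
       a \<oplus>\<^bsub>P\<^esub> b = Some c \<longrightarrow> a' \<oplus>\<^bsub>P\<^esub> b' = Some c' \<longrightarrow> (c, c') \<in> r) \<and>
    (\<forall>a\<in>carrier P. \<forall>b\<in>carrier P. a \<oplus>\<^bsub>P\<^esub> b \<noteq> None \<longrightarrow>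
       (\<forall>a'. (a', a) \<in> r \<longrightarrow> (\<exists>b'. (b', b) \<in> r \<and> a' \<oplus>\<^bsub>P\<^esub> b' \<noteq> None)) \<and>
       (\<forall>b'. (b', b) \<in> r \<longrightarrow> (\<exists>a'. (a', a) \<in> r \<and> a' \<oplus>\<^bsub>P\<^esub> b' \<noteq> None)))"

definition gamma_congruence ::
    "('a, 'm) partial_alg_scheme \<Rightarrow> ('a \<Rightarrow> 'a) \<Rightarrow> ('a \<times> 'a) set \<Rightarrow> bool" where
  "gamma_congruence P \<gamma> r \<longleftrightarrow> congruence P r \<and>
    (\<forall>a\<in>carrier P. \<forall>b\<in>carrier P. (a, b) \<in> r \<longleftrightarrow> (\<gamma> a, \<gamma> b) \<in> r)"

definition cond_C4 :: "('a, 'm) partial_alg_scheme \<Rightarrow> ('a \<times> 'a) set \<Rightarrow> bool" where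
  "cond_C4 P r \<longleftrightarrow>
    (\<forall>a\<in>carrier P. \<forall>b\<in>carrier P. \<forall>a'\<in>carrier P. \<forall>b'\<in>carrier P. (a, b) \<in> r \<longrightarrow>
      (\<exists>c d. a \<oplus>\<^bsub>P\<^esub> a' = Some c \<and> b \<oplus>\<^bsub>P\<^esub> b' = Some d \<and> (c, d) \<in> r) \<or>
      (\<exists>c d. a' \<oplus>\<^bsub>P\<^esub> a = Some c \<and> b' \<oplus>\<^bsub>P\<^esub> b = Some d \<and> (c, d) \<in> r) \<longrightarrow>
      (a', b') \<in> r)"

definition cond_C5' :: "('a, 'm) partial_alg_scheme \<Rightarrow> ('a \<times> 'a) set \<Rightarrow> bool" where
  "cond_C5' P r \<longleftrightarrow>
    (\<forall>a\<in>carrier P. \<forall>b\<in>carrier P. \<forall>c\<in>carrier P. \<forall>d.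
      b \<oplus>\<^bsub>P\<^esub> c = Some d \<longrightarrow> (a, d) \<in> r \<longrightarrow>
      (\<exists>a\<^sub>1 a\<^sub>2. (a\<^sub>1, b) \<in> r \<and> (a\<^sub>2, c) \<in> r \<and> a\<^sub>1 \<oplus>\<^bsub>P\<^esub> a\<^sub>2 = Some a))"

text \<open>
  The extension \<open>\<sim>\<^sup>*\<close> of \<open>\<sim>\<close> to the unitization. No element of \<open>P\<close> is related to an element of
  \<open>P\<^sup>\<eta>\<close> because \<open>r\<close> is a relation on \<open>P\<close> and \<open>P\<^sup>\<eta>\<close> is disjoint from \<open>P\<close>.
\<close>

definition ext_rel :: "('a \<Rightarrow> 'a) \<Rightarrow> ('a \<times> 'a) set \<Rightarrow> ('a \<times> 'a) set" where
  "ext_rel \<eta> r = r \<union> {(\<eta> a, \<eta> b) | a b. (a, b) \<in> r}"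

text \<open>
  The elements of the quotient are the equivalence classes, as sets; the class of \<open>a\<close> is
  \<open>r `` {a}\<close>. The definite description is well defined when \<open>r\<close> is a congruence.
\<close>

definition quot_psum ::
    "('a, 'm) partial_alg_scheme \<Rightarrow> ('a \<times> 'a) set \<Rightarrow> 'a set \<Rightarrow> 'a set \<Rightarrow> 'a set option" where
  "quot_psum P r A B =
    (if \<exists>a\<in>A. \<exists>b\<in>B. a \<oplus>\<^bsub>P\<^esub> b \<noteq> None
     then Some (THE C. \<exists>a\<in>A. \<exists>b\<in>B. \<exists>c. a \<oplus>\<^bsub>P\<^esub> b = Some c \<and> C = r `` {c})
     else None)"

definition quot_alg :: "'a partial_alg \<Rightarrow> ('a \<times> 'a) set \<Rightarrow> 'a set partial_alg" where
  "quot_alg P r =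
    \<lparr>carrier = carrier P // r, psum = quot_psum P r, zero = r `` {\<zero>\<^bsub>P\<^esub>}\<rparr>"

definition quot_unital_alg ::
    "'a unital_partial_alg \<Rightarrow> ('a \<times> 'a) set \<Rightarrow> 'a set unital_partial_alg" where
  "quot_unital_alg U r =
    \<lparr>carrier = carrier U // r, psum = quot_psum U r, zero = r `` {\<zero>\<^bsub>U\<^esub>}, one = r `` {\<one>\<^bsub>U\<^esub>}\<rparr>"

text \<open>
  The map \<open>[a] \<mapsto> [f a]\<close>, with classes on the right taken with respect to \<open>r\<close>: the union of the
  classes of all \<open>f a\<close> with \<open>a \<in> A\<close>, which is a single class when the map is well defined.
\<close>

definition quot_map :: "('a \<times> 'a) set \<Rightarrow> ('a \<Rightarrow> 'a) \<Rightarrow> 'a set \<Rightarrow> 'a set" where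
  "quot_map r f A = r `` (f ` A)"

section \<open>Ideals\<close>

definition pa_ideal :: "('a, 'm) partial_alg_scheme \<Rightarrow> 'a set \<Rightarrow> bool" where
  "pa_ideal P I \<longleftrightarrow> I \<subseteq> carrier P \<and> I \<noteq> {} \<and>
    (\<forall>i\<in>I. \<forall>a\<in>carrier P. a \<preceq>\<^bsub>P\<^esub> i \<longrightarrow> a \<in> I) \<and>
    (\<forall>i\<in>I. \<forall>j\<in>I. \<forall>k. i \<oplus>\<^bsub>P\<^esub> j = Some k \<longrightarrow> k \<in> I)"

definition normal_ideal :: "('a, 'm) partial_alg_scheme \<Rightarrow> 'a set \<Rightarrow> bool" where
  "normal_ideal P I \<longleftrightarrow> pa_ideal P I \<and>
    (\<forall>a\<in>carrier P. \<forall>b\<in>carrier P. \<forall>c\<in>carrier P. \<forall>d.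
      a \<oplus>\<^bsub>P\<^esub> c = Some d \<longrightarrow> c \<oplus>\<^bsub>P\<^esub> b = Some d \<longrightarrow> (a \<in> I \<longleftrightarrow> b \<in> I))"

definition gamma_ideal :: "('a, 'm) partial_alg_scheme \<Rightarrow> ('a \<Rightarrow> 'a) \<Rightarrow> 'a set \<Rightarrow> bool" where
  "gamma_ideal P \<gamma> I \<longleftrightarrow> pa_ideal P I \<and> (\<forall>a\<in>carrier P. a \<in> I \<longleftrightarrow> \<gamma> a \<in> I)"

definition riesz_ideal :: "('a, 'm) partial_alg_scheme \<Rightarrow> 'a set \<Rightarrow> bool" where
  "riesz_ideal P I \<longleftrightarrow> pa_ideal P I \<and>
    (\<forall>i\<in>I. \<forall>a\<in>carrier P. \<forall>b\<in>carrier P. \<forall>c. a \<oplus>\<^bsub>P\<^esub> b = Some c \<longrightarrow> i \<preceq>\<^bsub>P\<^esub> c \<longrightarrow>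
      (\<exists>j\<in>I. \<exists>k\<in>I. \<exists>m. j \<preceq>\<^bsub>P\<^esub> a \<and> k \<preceq>\<^bsub>P\<^esub> b \<and> j \<oplus>\<^bsub>P\<^esub> k = Some m \<and> i \<preceq>\<^bsub>P\<^esub> m)) \<and>
    (\<forall>i\<in>I. \<forall>a\<in>carrier P. \<forall>b\<in>carrier P. i \<preceq>\<^bsub>P\<^esub> a \<longrightarrow>
      (rdiff P a i \<oplus>\<^bsub>P\<^esub> b \<noteq> None \<longrightarrow>
        (\<exists>j\<in>I. j \<preceq>\<^bsub>P\<^esub> b \<and> a \<oplus>\<^bsub>P\<^esub> ldiff P j b \<noteq> None)) \<and>
      (b \<oplus>\<^bsub>P\<^esub> ldiff P i a \<noteq> None \<longrightarrow>
        (\<exists>k\<in>I. k \<preceq>\<^bsub>P\<^esub> b \<and> rdiff P b k \<oplus>\<^bsub>P\<^esub> a \<noteq> None)))"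

definition ideal_rel :: "('a, 'm) partial_alg_scheme \<Rightarrow> 'a set \<Rightarrow> ('a \<times> 'a) set" where
  "ideal_rel P I = {(a, b). a \<in> carrier P \<and> b \<in> carrier P \<and>
    (\<exists>i\<in>I. \<exists>j\<in>I. i \<preceq>\<^bsub>P\<^esub> a \<and> j \<preceq>\<^bsub>P\<^esub> b \<and> rdiff P a i = rdiff P b j)}"

definition cond_GCR :: "('a, 'm) partial_alg_scheme \<Rightarrow> 'a set \<Rightarrow> bool" where
  "cond_GCR P I \<longleftrightarrow> (\<forall>(a, b)\<in>ideal_rel P I.
    \<exists>i\<in>I. \<exists>j\<in>I. \<exists>c. i \<oplus>\<^bsub>P\<^esub> a = Some c \<and> j \<oplus>\<^bsub>P\<^esub> b = Some c)"

end

theory Submission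
  imports Defs
begin

text \<open>
  (C5') lets any decomposition of a class be lifted to a decomposition of a prescribed
  representative, which gives associativity and positivity of the quotient, and (C4) gives
  cancellation. In \<open>U\<close> both kinds of mixed sums are governed by sums in \<open>P\<close>:
  \<open>a + \<eta> b = \<eta> d\<close> means \<open>d \<oplus> a = b\<close>, and \<open>\<eta> a + b = \<eta> d\<close> means \<open>\<gamma> b \<oplus> d = a\<close>. This description
  passes to classes, so the quotient of \<open>U\<close> is again a unitization.

  For a normal ideal \<open>I\<close>, elements of \<open>I\<close> can be moved across any summand, so \<open>a\<close> and \<open>b\<close> are
  related iff \<open>x \<oplus> i = a\<close> and \<open>x \<oplus> j = b\<close> for some \<open>x\<close> and \<open>i, j \<in> I\<close>. Since (R1) makes the elements of
  \<open>I\<close> below a fixed element upward directed, having a common upper bound modulo \<open>I\<close> (as in (GCR))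
  also implies being related; transitivity and (C4) follow from this.
\<close>

section \<open>Sums as a ternary relation, and the order\<close>

definition is_sum :: "('a, 'm) partial_alg_scheme \<Rightarrow> 'a \<Rightarrow> 'a \<Rightarrow> 'a \<Rightarrow> bool" where
  "is_sum P a b c \<longleftrightarrow> a \<in> carrier P \<and> b \<in> carrier P \<and> a \<oplus>\<^bsub>P\<^esub> b = Some c"

lemma is_sum_unique: "is_sum P a b c \<Longrightarrow> is_sum P a b d \<Longrightarrow> c = d"
  by (simp add: is_sum_def)

lemma option_eqI: "(\<And>c. x = Some c \<longleftrightarrow> y = Some c) \<Longrightarrow> x = y"
  by (metis not_Some_eq)

context gpea
begin

lemma is_sum_closed:
  assumes "is_sum P a b c"
  shows "a \<in> carrier P" "b \<in> carrier P" "c \<in> carrier P"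
  using assms psum_closed by (auto simp: is_sum_def)

text \<open>Since \<open>is_sum\<close> carries membership of both summands, associativity holds
  without side conditions: if a summand lies outside the carrier, both sides are false.\<close>

lemma is_sum_assoc:
  "(\<exists>d. is_sum P a b d \<and> is_sum P d c e) \<longleftrightarrow> (\<exists>f. is_sum P b c f \<and> is_sum P a f e)"
proof (cases "a \<in> carrier P \<and> b \<in> carrier P \<and> c \<in> carrier P")
  case True
  then show ?thesis
    using psum_assoc[of a b c e] psum_closed unfolding is_sum_def by blast
next
  case False
  then show ?thesis by (auto simp: is_sum_def)
qed

lemma is_sum_assoc_right:
  assumes "is_sum P a b d" "is_sum P d c e"
  obtains f where "is_sum P b c f" "is_sum P a f e"
  using assms is_sum_assoc by blast

lemma is_sum_assoc_left:
  assumes "is_sum P b c f" "is_sum P a f e"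
  obtains d where "is_sum P a b d" "is_sum P d c e"
  using assms is_sum_assoc by blast

lemma is_sum_conjugate:
  assumes "is_sum P a b c"
  shows "\<exists>d. is_sum P d a c" "\<exists>e. is_sum P b e c"
  using assms psum_conjugation unfolding is_sum_def by blast+

lemma is_sum_left_cancel: "is_sum P a b d \<Longrightarrow> is_sum P a c d \<Longrightarrow> b = c"
  unfolding is_sum_def using psum_left_cancel by blast

lemma is_sum_right_cancel: "is_sum P b a d \<Longrightarrow> is_sum P c a d \<Longrightarrow> b = c"
  unfolding is_sum_def using psum_right_cancel by blast

lemma is_sum_zero_right: "a \<in> carrier P \<Longrightarrow> is_sum P a \<zero> a"
  by (simp add: is_sum_def psum_zero_right zero_closed)

lemma is_sum_zero_left: "a \<in> carrier P \<Longrightarrow> is_sum P \<zero> a a"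
  by (simp add: is_sum_def psum_zero_left zero_closed)

lemma is_sum_positive: "is_sum P a b \<zero> \<Longrightarrow> a = \<zero> \<and> b = \<zero>"
  unfolding is_sum_def using psum_positive by blast

lemma ple_iff_right: "a \<in> carrier P \<Longrightarrow> a \<preceq> b \<longleftrightarrow> (\<exists>c. is_sum P a c b)"
  by (auto simp: ple_def is_sum_def)

text \<open>Conjugation turns a right complement into a left one, so the two one-sided orders
  coincide.\<close>

lemma ple_iff_left: "a \<in> carrier P \<Longrightarrow> a \<preceq> b \<longleftrightarrow> (\<exists>c. is_sum P c a b)"
  using ple_iff_right is_sum_conjugate by blast

lemma ple_trans:
  assumes "a \<in> carrier P" "a \<preceq> b" "b \<preceq> c"
  shows "a \<preceq> c"
proof -
  obtain x where x: "is_sum P a x b" using assms ple_iff_right by blast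
  obtain y where "is_sum P b y c" using assms(3) is_sum_closed[OF x] ple_iff_right by blast
  then show ?thesis using x is_sum_assoc_right assms(1) ple_iff_right by metis
qed

lemma rdiff_eq: "is_sum P d a b \<Longrightarrow> rdiff P b a = d"
  unfolding rdiff_def is_sum_def using psum_right_cancel by blast

lemma ldiff_eq: "is_sum P a c b \<Longrightarrow> ldiff P a b = c"
  unfolding ldiff_def is_sum_def using psum_left_cancel by blast

text \<open>Uniqueness of differences replaces the definite description by a sum. The function
  \<open>f\<close> stands for \<open>\<eta>\<close> in \<open>U\<close> and for the induced map in
  the quotient.\<close>

lemma if_ple_rdiff_eq_Some:
  assumes "a \<in> carrier P"
  shows "(if a \<preceq> b then Some (f (rdiff P b a)) else None) = Some c \<longleftrightarrow>
    (\<exists>d. is_sum P d a b \<and> c = f d)"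
  using ple_iff_left[OF assms] by (auto simp: rdiff_eq; metis is_sum_right_cancel)

lemma if_ple_ldiff_eq_Some:
  assumes "a \<in> carrier P"
  shows "(if a \<preceq> b then Some (f (ldiff P a b)) else None) = Some c \<longleftrightarrow>
    (\<exists>d. is_sum P a d b \<and> c = f d)"
  using ple_iff_right[OF assms] by (auto simp: ldiff_eq; metis is_sum_left_cancel)

end

text \<open>Restates the axioms through \<open>is_sum\<close>. The two halves of associativity are
  separate assumptions because they lift to quotients by splitting different summands.\<close>

lemma gpeaI:
  assumes zero: "\<zero>\<^bsub>P\<^esub> \<in> carrier P"
    and closed: "\<And>a b c. is_sum P a b c \<Longrightarrow> c \<in> carrier P"
    and right: "\<And>a b c d e. is_sum P a b d \<Longrightarrow> is_sum P d c e \<Longrightarrow> \<exists>f. is_sum P b c f \<and> is_sum P a f e"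
    and left: "\<And>a b c f e. is_sum P b c f \<Longrightarrow> is_sum P a f e \<Longrightarrow> \<exists>d. is_sum P a b d \<and> is_sum P d c e"
    and conj: "\<And>a b c. is_sum P a b c \<Longrightarrow> (\<exists>d. is_sum P d a c) \<and> (\<exists>e. is_sum P b e c)"
    and lcancel: "\<And>a b c d. is_sum P a b d \<Longrightarrow> is_sum P a c d \<Longrightarrow> b = c"
    and rcancel: "\<And>a b c d. is_sum P b a d \<Longrightarrow> is_sum P c a d \<Longrightarrow> b = c"
    and zero_right: "\<And>a. a \<in> carrier P \<Longrightarrow> is_sum P a \<zero>\<^bsub>P\<^esub> a"
    and zero_left: "\<And>a. a \<in> carrier P \<Longrightarrow> is_sum P \<zero>\<^bsub>P\<^esub> a a"
    and pos: "\<And>a b. is_sum P a b \<zero>\<^bsub>P\<^esub> \<Longrightarrow> a = \<zero>\<^bsub>P\<^esub> \<and> b = \<zero>\<^bsub>P\<^esub>"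
  shows "gpea P"
proof
  fix a b c e
  assume *: "a \<in> carrier P" "b \<in> carrier P" "c \<in> carrier P"
  show "(\<exists>d. a \<oplus>\<^bsub>P\<^esub> b = Some d \<and> d \<oplus>\<^bsub>P\<^esub> c = Some e) \<longleftrightarrow>
    (\<exists>f. b \<oplus>\<^bsub>P\<^esub> c = Some f \<and> a \<oplus>\<^bsub>P\<^esub> f = Some e)" (is "?L \<longleftrightarrow> ?R")
  proof
    assume ?L
    then obtain d where "is_sum P a b d" "is_sum P d c e"
      using * closed[of a b] by (auto simp: is_sum_def)
    from right[OF this] show ?R by (auto simp: is_sum_def)
  next
    assume ?R
    then obtain f where "is_sum P b c f" "is_sum P a f e"
      using * closed[of b c] by (auto simp: is_sum_def)
    from left[OF this] show ?L by (auto simp: is_sum_def)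
  qed
next
  fix a b c assume "a \<in> carrier P" "b \<in> carrier P" "a \<oplus>\<^bsub>P\<^esub> b = Some c"
  then show "\<exists>d\<in>carrier P. \<exists>e\<in>carrier P. d \<oplus>\<^bsub>P\<^esub> a = Some c \<and> b \<oplus>\<^bsub>P\<^esub> e = Some c"
    using conj[of a b c] by (auto simp: is_sum_def)
next
  fix a b c d
  assume "a \<in> carrier P" "b \<in> carrier P" "c \<in> carrier P"
  then show "a \<oplus>\<^bsub>P\<^esub> b = Some d \<Longrightarrow> a \<oplus>\<^bsub>P\<^esub> c = Some d \<Longrightarrow> b = c"
    and "b \<oplus>\<^bsub>P\<^esub> a = Some d \<Longrightarrow> c \<oplus>\<^bsub>P\<^esub> a = Some d \<Longrightarrow> b = c"
    using lcancel[of a b d c] rcancel[of b a d c] by (auto simp: is_sum_def)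
next
  show "c \<in> carrier P" if "a \<in> carrier P" "b \<in> carrier P" "a \<oplus>\<^bsub>P\<^esub> b = Some c" for a b c
    using closed[of a b c] that by (simp add: is_sum_def)
  show "a = \<zero>\<^bsub>P\<^esub> \<and> b = \<zero>\<^bsub>P\<^esub>"
    if "a \<in> carrier P" "b \<in> carrier P" "a \<oplus>\<^bsub>P\<^esub> b = Some \<zero>\<^bsub>P\<^esub>" for a b
    using pos[of a b] that by (simp add: is_sum_def)
qed (use zero zero_right zero_left in \<open>auto simp: is_sum_def\<close>)

section \<open>Unitizing automorphisms and sums\<close>

lemma (in unitizing_automorphism) aut_closed: "a \<in> carrier P \<Longrightarrow> \<gamma> a \<in> carrier P"
  using aut_bij bij_betwE by blast

lemma (in unitizing_automorphism) aut_surj: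
  assumes "b \<in> carrier P" obtains a where "a \<in> carrier P" "b = \<gamma> a"
  using assms aut_bij by (auto simp: bij_betw_def)

lemma (in unitizing_automorphism) aut_inj:
  "a \<in> carrier P \<Longrightarrow> b \<in> carrier P \<Longrightarrow> \<gamma> a = \<gamma> b \<longleftrightarrow> a = b"
  using aut_bij by (auto simp: bij_betw_def inj_on_def)

text \<open>Preservation of sums is part of \<open>aut_psum\<close>; injectivity of
  \<open>\<gamma>\<close> adds that sums are reflected.\<close>

lemma (in unitizing_automorphism) aut_is_sum:
  assumes "a \<in> carrier P" "b \<in> carrier P" "c \<in> carrier P"
  shows "is_sum P (\<gamma> a) (\<gamma> b) (\<gamma> c) \<longleftrightarrow> is_sum P a b c"
  using assms aut_psum[of a b] aut_inj psum_closed[of a b] by (auto simp: is_sum_def aut_closed)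

section \<open>Quotients by congruences\<close>

lemma congruence_equiv: "congruence P r \<Longrightarrow> equiv (carrier P) r"
  by (simp add: congruence_def)

lemma congruence_is_sum:
  "congruence P r \<Longrightarrow> is_sum P a b c \<Longrightarrow> is_sum P a' b' c' \<Longrightarrow> (a, a') \<in> r \<Longrightarrow> (b, b') \<in> r \<Longrightarrow> (c, c') \<in> r"
  unfolding congruence_def is_sum_def by blast

lemma C4_left:
  assumes "cond_C4 P r" "is_sum P a a' c" "is_sum P b b' d" "(a, b) \<in> r" "(c, d) \<in> r"
  shows "(a', b') \<in> r"
  using assms unfolding cond_C4_def is_sum_def by blast

lemma C4_right:
  assumes "cond_C4 P r" "is_sum P a' a c" "is_sum P b' b d" "(a, b) \<in> r" "(c, d) \<in> r"
  shows "(a', b') \<in> r"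
  using assms unfolding cond_C4_def is_sum_def by blast

lemma C5'_is_sum:
  assumes "equiv (carrier P) r" "cond_C5' P r" "is_sum P b c d" "(a, d) \<in> r"
  obtains a1 a2 where "(a1, b) \<in> r" "(a2, c) \<in> r" "is_sum P a1 a2 a"
  using assms equiv_type[OF assms(1)] unfolding cond_C5'_def is_sum_def by blast

text \<open>By (C2) all choices of representatives give the same class, so the definite description
  is proper. Having (C2) as an explicit assumption lets the lemma serve \<open>r\<close> on
  \<open>P\<close> as well as \<open>ext_rel \<eta> r\<close> on \<open>U\<close>.\<close>

lemma quot_psum_eq_Some:
  assumes "equiv (carrier P) r" "A \<in> carrier P // r" "B \<in> carrier P // r"
    and C2: "\<And>a a' b b' c c'. (a, a') \<in> r \<Longrightarrow> (b, b') \<in> r \<Longrightarrow>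
      is_sum P a b c \<Longrightarrow> is_sum P a' b' c' \<Longrightarrow> (c, c') \<in> r"
  shows "quot_psum P r A B = Some C \<longleftrightarrow> (\<exists>a\<in>A. \<exists>b\<in>B. \<exists>c. is_sum P a b c \<and> C = r `` {c})"
proof -
  have sub: "A \<subseteq> carrier P" "B \<subseteq> carrier P"
    using assms(1-3) by (meson in_quotient_imp_subset)+
  have eq: "C = C'"
    if h: "\<exists>a\<in>A. \<exists>b\<in>B. \<exists>c. is_sum P a b c \<and> C = r `` {c}"
      "\<exists>a\<in>A. \<exists>b\<in>B. \<exists>c. is_sum P a b c \<and> C' = r `` {c}" for C C'
  proof -
    obtain a b c where abc: "a \<in> A" "b \<in> B" "is_sum P a b c" "C = r `` {c}" using h(1) by blast
    obtain a' b' c' where abc': "a' \<in> A" "b' \<in> B" "is_sum P a' b' c'" "C' = r `` {c'}"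
      using h(2) by blast
    have "(a, a') \<in> r" "(b, b') \<in> r"
      using quotient_eq_iff[OF assms(1)] assms(2,3) abc abc' by blast+
    then have "(c, c') \<in> r" using C2 abc abc' by blast
    then show ?thesis using equiv_class_eq[OF assms(1)] abc abc' by blast
  qed
  \<comment> \<open>The carrier conditions inside \<open>is_sum\<close> are automatic here, since
    classes are subsets of the carrier.\<close>
  have form: "quot_psum P r A B = (if \<exists>a\<in>A. \<exists>b\<in>B. \<exists>c. is_sum P a b c
      then Some (THE C. \<exists>a\<in>A. \<exists>b\<in>B. \<exists>c. is_sum P a b c \<and> C = r `` {c}) else None)"
    using sub unfolding quot_psum_def is_sum_def by (auto intro!: arg_cong[where f = The] ext)
  show ?thesis
  proof (cases "\<exists>a\<in>A. \<exists>b\<in>B. \<exists>c. is_sum P a b c")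
    case True
    then obtain C0 where C0: "\<exists>a\<in>A. \<exists>b\<in>B. \<exists>c. is_sum P a b c \<and> C0 = r `` {c}" by blast
    have "(THE C. \<exists>a\<in>A. \<exists>b\<in>B. \<exists>c. is_sum P a b c \<and> C = r `` {c}) = C0"
      using C0 eq[OF _ C0] by (rule the_equality)
    then have Some: "quot_psum P r A B = Some C0" unfolding form if_P[OF True] by (rule arg_cong)
    show ?thesis
    proof
      assume "quot_psum P r A B = Some C"
      then have "C0 = C" unfolding Some by (rule option.inject[THEN iffD1])
      then show "\<exists>a\<in>A. \<exists>b\<in>B. \<exists>c. is_sum P a b c \<and> C = r `` {c}" using C0 by (rule subst)
    next
      assume "\<exists>a\<in>A. \<exists>b\<in>B. \<exists>c. is_sum P a b c \<and> C = r `` {c}"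
      then show "quot_psum P r A B = Some C" unfolding Some using eq[OF C0] by simp
    qed
  qed (use form in auto)
qed

section \<open>The quotient as a generalized pseudo effect algebra\<close>

locale quotientable = gpea P for P :: "'a partial_alg" (structure) +
  fixes r :: "('a \<times> 'a) set"
  assumes cong: "congruence P r" and C4: "cond_C4 P r" and C5': "cond_C5' P r"
begin

abbreviation Q :: "'a set partial_alg" where "Q \<equiv> quot_alg P r"

lemma equiv: "equiv (carrier P) r"
  using cong by (rule congruence_equiv)

lemma rel_closed: "(a, b) \<in> r \<Longrightarrow> a \<in> carrier P \<and> b \<in> carrier P"
  using equiv_type[OF equiv] by blast

lemma rel_refl: "a \<in> carrier P \<Longrightarrow> (a, a) \<in> r"
  using equiv by (simp add: equiv_def refl_on_def)

lemma rel_sym: "(a, b) \<in> r \<Longrightarrow> (b, a) \<in> r"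
  using equiv by (meson equivE symE)

lemma rel_trans: "(a, b) \<in> r \<Longrightarrow> (b, c) \<in> r \<Longrightarrow> (a, c) \<in> r"
  using equiv by (meson equivE transE)

lemma class_eq_iff: "a \<in> carrier P \<Longrightarrow> b \<in> carrier P \<Longrightarrow> r `` {a} = r `` {b} \<longleftrightarrow> (a, b) \<in> r"
  using eq_equiv_class_iff[OF equiv] by blast

lemma carrier_Q: "carrier Q = carrier P // r"
  by (simp add: quot_alg_def)

lemma class_in_Q: "a \<in> carrier P \<Longrightarrow> r `` {a} \<in> carrier Q"
  by (simp add: carrier_Q quotientI)

lemma in_Q_E: assumes "A \<in> carrier Q" obtains a where "a \<in> carrier P" "A = r `` {a}"
  using assms by (auto simp: carrier_Q elim: quotientE)

lemma psum_Q_eq_Some: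
  assumes "A \<in> carrier Q" "B \<in> carrier Q"
  shows "A \<oplus>\<^bsub>Q\<^esub> B = Some C \<longleftrightarrow> (\<exists>a\<in>A. \<exists>b\<in>B. \<exists>c. is_sum P a b c \<and> C = r `` {c})"
  using quot_psum_eq_Some[OF equiv, of A B C] assms congruence_is_sum[OF cong]
  by (simp add: quot_alg_def)

text \<open>Any member of a class generates it, so a sum of classes is exactly the image of a sum in
  \<open>P\<close>. This moves every argument about the quotient to representatives.\<close>

lemma is_sum_Q_iff:
  "is_sum Q A B C \<longleftrightarrow>
    (\<exists>a b c. is_sum P a b c \<and> A = r `` {a} \<and> B = r `` {b} \<and> C = r `` {c})" (is "?L \<longleftrightarrow> ?R")
proof
  assume ?L
  then have AB: "A \<in> carrier Q" "B \<in> carrier Q" and eq: "A \<oplus>\<^bsub>Q\<^esub> B = Some C"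
    by (auto simp: is_sum_def)
  then obtain a b c where mem: "a \<in> A" "b \<in> B" and sum: "is_sum P a b c" "C = r `` {c}"
    using psum_Q_eq_Some[OF AB, THEN iffD1, OF eq] by blast
  obtain a' b' where "A = r `` {a'}" "B = r `` {b'}" using AB in_Q_E by metis
  with mem have "A = r `` {a}" "B = r `` {b}"
    using equiv_class_eq[OF equiv] by blast+
  with sum show ?R by blast
next
  assume ?R
  then obtain a b c where *: "is_sum P a b c" "A = r `` {a}" "B = r `` {b}" "C = r `` {c}"
    by blast
  have "a \<in> A" "b \<in> B" and AB: "A \<in> carrier Q" "B \<in> carrier Q"
    using is_sum_closed(1,2)[OF *(1)] *(2,3) rel_refl class_in_Q by auto
  with * have "A \<oplus>\<^bsub>Q\<^esub> B = Some C" by (subst psum_Q_eq_Some) blast+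
  with AB show ?L by (simp add: is_sum_def)
qed

lemma is_sum_QI: "is_sum P a b c \<Longrightarrow> is_sum Q (r `` {a}) (r `` {b}) (r `` {c})"
  unfolding is_sum_Q_iff by (intro exI conjI) (assumption | rule refl)+

lemma is_sum_QE:
  assumes "is_sum Q A B C"
  obtains a b c where "is_sum P a b c" "A = r `` {a}" "B = r `` {b}" "C = r `` {c}"
  using is_sum_Q_iff[THEN iffD1, OF assms] by (elim exE conjE)

lemma class_eqD: "r `` {a} = r `` {b} \<Longrightarrow> a \<in> carrier P \<Longrightarrow> b \<in> carrier P \<Longrightarrow> (a, b) \<in> r"
  by (simp add: class_eq_iff)

text \<open>The representatives witnessing a sum of classes may add up to another member of the
  class of \<open>c\<close>; (C5') transports the splitting to \<open>c\<close> itself.\<close>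

lemma is_sum_Q_decompose:
  assumes "is_sum Q A B (r `` {c})" "c \<in> carrier P"
  obtains a b where "is_sum P a b c" "A = r `` {a}" "B = r `` {b}"
proof -
  obtain a1 b1 c1 where *: "is_sum P a1 b1 c1" "A = r `` {a1}" "B = r `` {b1}" "r `` {c} = r `` {c1}"
    using is_sum_QE[OF assms(1)] .
  have "(c, c1) \<in> r" using class_eqD *(4) assms(2) is_sum_closed(3)[OF *(1)] .
  then obtain a b where ab: "(a, a1) \<in> r" "(b, b1) \<in> r" "is_sum P a b c"
    using C5'_is_sum[OF equiv C5' *(1)] by metis
  then have "A = r `` {a}" "B = r `` {b}"
    using *(2,3) equiv_class_eq[OF equiv ab(1)] equiv_class_eq[OF equiv ab(2)] by simp_all
  with ab(3) show thesis by (rule that)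
qed

lemma gpea_Q: "gpea Q"
proof (rule gpeaI)
  have zQ: "\<zero>\<^bsub>Q\<^esub> = r `` {\<zero>}" by (simp add: quot_alg_def)
  show "\<zero>\<^bsub>Q\<^esub> \<in> carrier Q" unfolding zQ by (intro class_in_Q zero_closed)
  show "C \<in> carrier Q" if h: "is_sum Q A B C" for A B C
    by (rule is_sum_QE[OF h]) (simp add: class_in_Q is_sum_closed)
  show "\<exists>F. is_sum Q B C F \<and> is_sum Q A F E" if h: "is_sum Q A B D" "is_sum Q D C E" for A B C D E
  proof -
    obtain d c e where d: "is_sum P d c e" "D = r `` {d}" "C = r `` {c}" "E = r `` {e}"
      using is_sum_QE[OF h(2)] .
    \<comment> \<open>Splitting the very representative \<open>d\<close> that occurs in the outer
      sum makes the two sums composable in \<open>P\<close>.\<close>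
    obtain a b where ab: "is_sum P a b d" "A = r `` {a}" "B = r `` {b}"
      using is_sum_Q_decompose h(1) is_sum_closed(1)[OF d(1)] unfolding d(2) .
    obtain f where "is_sum P b c f" "is_sum P a f e" using is_sum_assoc_right[OF ab(1) d(1)] .
    then show ?thesis using d ab is_sum_QI by blast
  qed
  show "\<exists>D. is_sum Q A B D \<and> is_sum Q D C E" if h: "is_sum Q B C F" "is_sum Q A F E" for A B C F E
  proof -
    obtain a f e where f: "is_sum P a f e" "A = r `` {a}" "F = r `` {f}" "E = r `` {e}"
      using is_sum_QE[OF h(2)] .
    obtain b c where bc: "is_sum P b c f" "B = r `` {b}" "C = r `` {c}"
      using is_sum_Q_decompose h(1) is_sum_closed(2)[OF f(1)] unfolding f(3) .
    obtain d where "is_sum P a b d" "is_sum P d c e" using is_sum_assoc_left[OF bc(1) f(1)] .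
    then show ?thesis using f bc is_sum_QI by blast
  qed
  show "(\<exists>D. is_sum Q D A C) \<and> (\<exists>E. is_sum Q B E C)" if h: "is_sum Q A B C" for A B C
  proof -
    obtain a b c where s: "is_sum P a b c" "A = r `` {a}" "B = r `` {b}" "C = r `` {c}"
      using is_sum_QE[OF h] .
    show ?thesis using is_sum_conjugate[OF s(1)] is_sum_QI unfolding s(2-4) by blast
  qed
  show "B = C" if h: "is_sum Q A B D" "is_sum Q A C D" for A B C D
  proof -
    obtain a b d where b: "is_sum P a b d" "A = r `` {a}" "B = r `` {b}" "D = r `` {d}"
      using is_sum_QE[OF h(1)] .
    \<comment> \<open>Both sums are given the same total \<open>d\<close>, so that (C4) applies with
      reflexivity on the totals.\<close>
    obtain a' c where c: "is_sum P a' c d" "A = r `` {a'}" "C = r `` {c}"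
      using is_sum_Q_decompose h(2) is_sum_closed(3)[OF b(1)] unfolding b(4) .
    have "(a, a') \<in> r"
      using class_eqD b(2) c(2) is_sum_closed(1)[OF b(1)] is_sum_closed(1)[OF c(1)] by simp
    then have "(b, c) \<in> r"
      using C4_left[OF C4 b(1) c(1)] rel_refl is_sum_closed(3)[OF b(1)] by simp
    then show ?thesis unfolding b(3) c(3) by (rule equiv_class_eq[OF equiv])
  qed
  show "B = C" if h: "is_sum Q B A D" "is_sum Q C A D" for A B C D
  proof -
    obtain b a d where b: "is_sum P b a d" "B = r `` {b}" "A = r `` {a}" "D = r `` {d}"
      using is_sum_QE[OF h(1)] .
    obtain c a' where c: "is_sum P c a' d" "C = r `` {c}" "A = r `` {a'}"
      using is_sum_Q_decompose h(2) is_sum_closed(3)[OF b(1)] unfolding b(4) .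
    have "(a, a') \<in> r"
      using class_eqD b(3) c(3) is_sum_closed(2)[OF b(1)] is_sum_closed(2)[OF c(1)] by simp
    then have "(b, c) \<in> r"
      using C4_right[OF C4 b(1) c(1)] rel_refl is_sum_closed(3)[OF b(1)] by simp
    then show ?thesis unfolding b(2) c(2) by (rule equiv_class_eq[OF equiv])
  qed
  show "is_sum Q A \<zero>\<^bsub>Q\<^esub> A" if h: "A \<in> carrier Q" for A
    by (rule in_Q_E[OF h]) (simp add: zQ is_sum_QI is_sum_zero_right)
  show "is_sum Q \<zero>\<^bsub>Q\<^esub> A A" if h: "A \<in> carrier Q" for A
    by (rule in_Q_E[OF h]) (simp add: zQ is_sum_QI is_sum_zero_left)
  show "A = \<zero>\<^bsub>Q\<^esub> \<and> B = \<zero>\<^bsub>Q\<^esub>" if h: "is_sum Q A B \<zero>\<^bsub>Q\<^esub>" for A B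
  proof -
    \<comment> \<open>Splitting \<open>\<zero>\<close> itself, rather than some element related to
      it, makes positivity of \<open>P\<close> applicable.\<close>
    obtain a b where "is_sum P a b \<zero>" "A = r `` {a}" "B = r `` {b}"
      using is_sum_Q_decompose h zero_closed unfolding zQ .
    then show ?thesis using is_sum_positive unfolding zQ by blast
  qed
qed

end

section \<open>The automorphism induced on classes\<close>

lemma quot_map_class:
  assumes "equiv X r" "equiv Y s" "a \<in> X" "\<And>b c. (b, c) \<in> r \<Longrightarrow> (f b, f c) \<in> s"
  shows "quot_map s f (r `` {a}) = s `` {f a}"
proof -
  have "(a, a) \<in> r" using assms(1,3) by (simp add: equiv_def refl_on_def)
  moreover have "s `` {f b} = s `` {f a}" if "(a, b) \<in> r" for b
    using that assms(2,4) equiv_class_eq by metis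
  ultimately show ?thesis unfolding quot_map_def by blast
qed

locale gamma_quotientable = quotientable P r + unitizing_automorphism P \<gamma>
  for P :: "'a partial_alg" (structure) and r \<gamma> +
  assumes rel_aut: "\<lbrakk>a \<in> carrier P; b \<in> carrier P\<rbrakk> \<Longrightarrow> (\<gamma> a, \<gamma> b) \<in> r \<longleftrightarrow> (a, b) \<in> r"
begin

lemma quot_aut_class: "a \<in> carrier P \<Longrightarrow> quot_map r \<gamma> (r `` {a}) = r `` {\<gamma> a}"
  using quot_map_class[OF equiv equiv] rel_aut rel_closed by blast

text \<open>Forwards, the witnessing representatives are pulled back along the surjection
  \<open>\<gamma>\<close>, and \<open>rel_aut\<close> shows that the preimages lie in the classes
  \<open>A\<close> and \<open>B\<close>. Existence and value of the image sum are handled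
  together.\<close>

lemma is_sum_quot_aut:
  assumes "A \<in> carrier Q" "B \<in> carrier Q"
  shows "is_sum Q (quot_map r \<gamma> A) (quot_map r \<gamma> B) C \<longleftrightarrow>
    (\<exists>D. is_sum Q A B D \<and> C = quot_map r \<gamma> D)" (is "?L \<longleftrightarrow> ?R")
proof
  obtain a b where ab: "a \<in> carrier P" "A = r `` {a}" "b \<in> carrier P" "B = r `` {b}"
    using assms in_Q_E by metis
  assume ?L
  then obtain x y z where x: "is_sum P x y z" "r `` {\<gamma> a} = r `` {x}" "r `` {\<gamma> b} = r `` {y}" "C = r `` {z}"
    using ab quot_aut_class is_sum_Q_iff by metis
  obtain a' b' c' where abc: "a' \<in> carrier P" "x = \<gamma> a'" "b' \<in> carrier P" "y = \<gamma> b'" "c' \<in> carrier P" "z = \<gamma> c'"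
    using is_sum_closed[OF x(1)] aut_surj by metis
  then have "is_sum P a' b' c'" "r `` {a} = r `` {a'}" "r `` {b} = r `` {b'}"
    using x ab aut_is_sum class_eq_iff rel_aut aut_closed by metis+
  then show ?R using ab is_sum_Q_iff abc x(4) quot_aut_class by metis
next
  assume ?R
  then obtain a b c where *: "is_sum P a b c" "A = r `` {a}" "B = r `` {b}" "C = quot_map r \<gamma> (r `` {c})"
    using is_sum_Q_iff by metis
  then have "is_sum P (\<gamma> a) (\<gamma> b) (\<gamma> c)" using aut_is_sum is_sum_closed by blast
  then show ?L using * is_sum_closed[OF *(1)] quot_aut_class is_sum_Q_iff by metis
qed

lemma quot_aut_closed: "A \<in> carrier Q \<Longrightarrow> quot_map r \<gamma> A \<in> carrier Q"
  using in_Q_E quot_aut_class class_in_Q aut_closed by metis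

lemma unitizing_automorphism_Q: "unitizing_automorphism Q (quot_map r \<gamma>)"
proof (intro unitizing_automorphism.intro unitizing_automorphism_axioms.intro gpea_Q)
  have "inj_on (quot_map r \<gamma>) (carrier Q)"
  proof (rule inj_onI)
    fix A B assume *: "A \<in> carrier Q" "B \<in> carrier Q" "quot_map r \<gamma> A = quot_map r \<gamma> B"
    obtain a b where ab: "a \<in> carrier P" "A = r `` {a}" "b \<in> carrier P" "B = r `` {b}"
      using * in_Q_E by metis
    then have "r `` {\<gamma> a} = r `` {\<gamma> b}" using *(3) by (simp add: quot_aut_class)
    then have "(a, b) \<in> r" using ab by (simp add: class_eq_iff rel_aut aut_closed)
    then show "A = B" using ab equiv_class_eq[OF equiv] by simp
  qed
  moreover have "carrier Q \<subseteq> quot_map r \<gamma> ` carrier Q"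
  proof
    fix B assume "B \<in> carrier Q"
    then obtain b where b: "b \<in> carrier P" "B = r `` {b}" by (rule in_Q_E)
    obtain a where "a \<in> carrier P" "b = \<gamma> a" using aut_surj[OF b(1)] .
    with b(2) show "B \<in> quot_map r \<gamma> ` carrier Q"
      by (auto simp: quot_aut_class class_in_Q intro!: image_eqI[of _ _ "r `` {a}"])
  qed
  ultimately show "bij_betw (quot_map r \<gamma>) (carrier Q) (carrier Q)"
    unfolding bij_betw_def using quot_aut_closed by blast
next
  fix A B assume *: "A \<in> carrier Q" "B \<in> carrier Q"
  show "quot_map r \<gamma> A \<oplus>\<^bsub>Q\<^esub> quot_map r \<gamma> B = map_option (quot_map r \<gamma>) (A \<oplus>\<^bsub>Q\<^esub> B)"
  proof (rule option_eqI)
    fix C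
    show "quot_map r \<gamma> A \<oplus>\<^bsub>Q\<^esub> quot_map r \<gamma> B = Some C \<longleftrightarrow>
      map_option (quot_map r \<gamma>) (A \<oplus>\<^bsub>Q\<^esub> B) = Some C"
      using is_sum_quot_aut[OF *, of C] * quot_aut_closed by (auto simp: is_sum_def)
  qed
  obtain a b where ab: "a \<in> carrier P" "A = r `` {a}" "b \<in> carrier P" "B = r `` {b}"
    using * in_Q_E by metis
  \<comment> \<open>The unitizing law concerns existence only, so one suitable pair of
    representatives settles each direction.\<close>
  have "(\<exists>C. is_sum Q (quot_map r \<gamma> A) B C) \<longleftrightarrow> (\<exists>C. is_sum Q B A C)"
  proof
    assume "\<exists>C. is_sum Q (quot_map r \<gamma> A) B C"
    then obtain x y z where x: "is_sum P x y z" "r `` {\<gamma> a} = r `` {x}" "B = r `` {y}"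
      using ab quot_aut_class is_sum_Q_iff by metis
    obtain a' where a': "a' \<in> carrier P" "x = \<gamma> a'" using is_sum_closed[OF x(1)] aut_surj by metis
    obtain d where "is_sum P y a' d" using unitizing[of a' y] x a' by (auto simp: is_sum_def)
    moreover have "A = r `` {a'}" using ab x a' class_eq_iff rel_aut aut_closed by metis
    ultimately show "\<exists>C. is_sum Q B A C" using x is_sum_Q_iff by blast
  next
    assume "\<exists>C. is_sum Q B A C"
    then obtain b' a' c where x: "is_sum P b' a' c" "B = r `` {b'}" "A = r `` {a'}"
      using is_sum_Q_iff by metis
    obtain d where "is_sum P (\<gamma> a') b' d"
      using unitizing[of a' b'] x aut_closed by (auto simp: is_sum_def)
    then show "\<exists>C. is_sum Q (quot_map r \<gamma> A) B C"
      using x is_sum_Q_iff quot_aut_class is_sum_closed by metis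
  qed
  then show "quot_map r \<gamma> A \<oplus>\<^bsub>Q\<^esub> B \<noteq> None \<longleftrightarrow> B \<oplus>\<^bsub>Q\<^esub> A \<noteq> None"
    using * quot_aut_closed by (auto simp: is_sum_def)
qed

end

section \<open>Quotients of the unitization\<close>

context gamma_unitization
begin

lemma eta_in_U: "a \<in> carrier P \<Longrightarrow> \<eta> a \<in> carrier U"
  by (simp add: carrier_U)

lemma eta_notin: "a \<in> carrier P \<Longrightarrow> \<eta> a \<notin> carrier P"
  using eta_disjoint by blast

lemma eta_eq_iff: "a \<in> carrier P \<Longrightarrow> b \<in> carrier P \<Longrightarrow> \<eta> a = \<eta> b \<longleftrightarrow> a = b"
  using eta_inj by (auto simp: inj_on_def)

lemma is_sum_U: "a \<in> carrier P \<Longrightarrow> b \<in> carrier P \<Longrightarrow> is_sum U a b c \<longleftrightarrow> is_sum P a b c"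
  by (simp add: is_sum_def carrier_U psum_U)

lemma is_sum_U_eta_right:
  "a \<in> carrier P \<Longrightarrow> b \<in> carrier P \<Longrightarrow> is_sum U a (\<eta> b) c \<longleftrightarrow> (\<exists>d. is_sum P d a b \<and> c = \<eta> d)"
  using if_ple_rdiff_eq_Some[of a b \<eta> c] by (simp add: is_sum_def[of U] carrier_U psum_U_eta_right)

lemma is_sum_U_eta_left:
  "a \<in> carrier P \<Longrightarrow> b \<in> carrier P \<Longrightarrow> is_sum U (\<eta> a) b c \<longleftrightarrow> (\<exists>d. is_sum P (\<gamma> b) d a \<and> c = \<eta> d)"
  using if_ple_ldiff_eq_Some[of "\<gamma> b" a \<eta> c] aut_closed
  by (simp add: is_sum_def[of U] carrier_U psum_U_eta_left)

lemma is_sum_U_eta_eta: "a \<in> carrier P \<Longrightarrow> b \<in> carrier P \<Longrightarrow> \<not> is_sum U (\<eta> a) (\<eta> b) c"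
  by (simp add: is_sum_def psum_U_eta_eta)

end

section \<open>The extended congruence on the unitization\<close>

locale quotient_unitization = gamma_quotientable P r \<gamma> + gamma_unitization P \<gamma> \<eta> U
  for P :: "'a partial_alg" (structure) and r \<gamma> \<eta> and U :: "'a unital_partial_alg"
begin

abbreviation s :: "('a \<times> 'a) set" where "s \<equiv> ext_rel \<eta> r"

lemma ext_rel_P: "a \<in> carrier P \<Longrightarrow> (a, b) \<in> s \<longleftrightarrow> (a, b) \<in> r"
  using eta_notin rel_closed by (auto simp: ext_rel_def)

lemma ext_rel_eta: "a \<in> carrier P \<Longrightarrow> (\<eta> a, b) \<in> s \<longleftrightarrow> (\<exists>c. b = \<eta> c \<and> (a, c) \<in> r)"
  using eta_notin rel_closed eta_eq_iff unfolding ext_rel_def by blast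

lemma ext_rel_eta_eta: "a \<in> carrier P \<Longrightarrow> b \<in> carrier P \<Longrightarrow> (\<eta> a, \<eta> b) \<in> s \<longleftrightarrow> (a, b) \<in> r"
  using ext_rel_eta eta_eq_iff rel_closed by metis

lemma in_U_cases:
  assumes "x \<in> carrier U"
  obtains (P) "x \<in> carrier P" | (eta) a where "a \<in> carrier P" "x = \<eta> a"
  using assms carrier_U by blast

text \<open>The classes agree as sets, so the quotient of \<open>P\<close> is literally a subset of
  the quotient of \<open>U\<close>, as \<open>gamma_unitization\<close> demands.\<close>

lemma ext_rel_class_P: "a \<in> carrier P \<Longrightarrow> s `` {a} = r `` {a}"
  using ext_rel_P by blast

lemma equiv_ext_rel: "equiv (carrier U) s"
proof (rule equivI)
  show "s \<subseteq> carrier U \<times> carrier U"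
    using rel_closed by (auto simp: ext_rel_def carrier_U)
  show "refl_on (carrier U) s"
    by (auto simp: refl_on_def ext_rel_P ext_rel_eta_eta rel_refl elim!: in_U_cases)
  show "sym s"
    using rel_sym by (auto simp: ext_rel_def intro!: symI)
  show "trans s"
  proof (rule transI)
    fix x y z assume *: "(x, y) \<in> s" "(y, z) \<in> s"
    then have "x \<in> carrier U" using rel_closed by (auto simp: ext_rel_def carrier_U)
    then show "(x, z) \<in> s"
    proof (cases rule: in_U_cases)
      case P
      then show ?thesis using * ext_rel_P rel_closed rel_trans by metis
    next
      case (eta a)
      then obtain b where "y = \<eta> b" "(a, b) \<in> r" using * ext_rel_eta by metis
      then show ?thesis using eta * ext_rel_eta rel_closed rel_trans by metis
    qed
  qed
qed

text \<open>A mixed sum is \<open>\<eta>\<close> of a difference in \<open>P\<close>, so its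
  compatibility with the relation is a cancellation property, namely (C4). When the
  \<open>\<eta>\<close>-summand is on the left, the relation must first be carried through
  \<open>\<gamma>\<close>.\<close>

lemma ext_rel_is_sum:
  assumes a: "(a, a') \<in> s" and b: "(b, b') \<in> s" and sums: "is_sum U a b c" "is_sum U a' b' c'"
  shows "(c, c') \<in> s"
proof -
  have "a \<in> carrier U" "b \<in> carrier U" using sums by (auto simp: is_sum_def)
  then show ?thesis
  proof (cases rule: in_U_cases[case_product in_U_cases])
    case P_P
    then have ab: "(a, a') \<in> r" "(b, b') \<in> r" using a b ext_rel_P by auto
    then have "is_sum P a b c" "is_sum P a' b' c'" using sums is_sum_U rel_closed by auto
    then have "(c, c') \<in> r" using ab by (rule congruence_is_sum[OF cong])
    then show ?thesis by (simp add: ext_rel_def)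
  next
    case (P_eta x)
    obtain x' where x': "b' = \<eta> x'" "(x, x') \<in> r"
      using b P_eta ext_rel_eta by auto
    have a: "(a, a') \<in> r" using a P_eta ext_rel_P by auto
    obtain d where d: "is_sum P d a x" "c = \<eta> d"
      using sums(1) P_eta is_sum_U_eta_right by auto
    obtain d' where d': "is_sum P d' a' x'" "c' = \<eta> d'"
      using sums(2) x' rel_closed[OF a] rel_closed[OF x'(2)] is_sum_U_eta_right by auto
    have "(d, d') \<in> r" using C4 d(1) d'(1) a x'(2) by (rule C4_right)
    then show ?thesis using d(2) d'(2) by (auto simp: ext_rel_def)
  next
    case (eta_P x)
    obtain x' where x': "a' = \<eta> x'" "(x, x') \<in> r"
      using a eta_P ext_rel_eta by auto
    have b: "(b, b') \<in> r" using b eta_P ext_rel_P by auto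
    obtain d where d: "is_sum P (\<gamma> b) d x" "c = \<eta> d"
      using sums(1) eta_P is_sum_U_eta_left by auto
    obtain d' where d': "is_sum P (\<gamma> b') d' x'" "c' = \<eta> d'"
      using sums(2) x' rel_closed[OF b] rel_closed[OF x'(2)] is_sum_U_eta_left by auto
    have "(\<gamma> b, \<gamma> b') \<in> r" using b rel_aut rel_closed[OF b] by simp
    then have "(d, d') \<in> r" using x'(2) by (rule C4_left[OF C4 d(1) d'(1)])
    then show ?thesis using d(2) d'(2) by (auto simp: ext_rel_def)
  next
    case (eta_eta x y)
    then show ?thesis using sums is_sum_U_eta_eta by blast
  qed
qed

lemma quot_eta_class: "a \<in> carrier P \<Longrightarrow> quot_map s \<eta> (r `` {a}) = s `` {\<eta> a}"
  using quot_map_class[OF equiv equiv_ext_rel] ext_rel_eta_eta rel_closed by blast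

section \<open>Partial sums in the quotient of the unitization\<close>

abbreviation V :: "'a set unital_partial_alg" where "V \<equiv> quot_unital_alg U s"

lemma carrier_V: "carrier V = carrier Q \<union> quot_map s \<eta> ` carrier Q"
proof -
  have "carrier V = (\<lambda>x. s `` {x}) ` carrier U" "carrier Q = (\<lambda>x. r `` {x}) ` carrier P"
    by (auto simp: quot_unital_alg_def quot_alg_def quotient_def)
  then show ?thesis
    by (simp add: carrier_U image_Un image_image ext_rel_class_P quot_eta_class)
qed

lemma psum_V_eq_Some:
  assumes "x \<in> carrier U" "y \<in> carrier U"
  shows "s `` {x} \<oplus>\<^bsub>V\<^esub> s `` {y} = Some C \<longleftrightarrow>
    (\<exists>x' y' z. (x, x') \<in> s \<and> (y, y') \<in> s \<and> is_sum U x' y' z \<and> C = s `` {z})"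
proof -
  have "quot_psum U s (s `` {x}) (s `` {y}) = Some C \<longleftrightarrow>
    (\<exists>x'\<in>s `` {x}. \<exists>y'\<in>s `` {y}. \<exists>z. is_sum U x' y' z \<and> C = s `` {z})"
    using equiv_ext_rel quotientI[OF assms(1)] quotientI[OF assms(2)] ext_rel_is_sum
    by (rule quot_psum_eq_Some)
  then show ?thesis by (simp add: quot_unital_alg_def Bex_def)
qed

lemma psum_V_P_P:
  assumes "a \<in> carrier P" "b \<in> carrier P"
  shows "s `` {a} \<oplus>\<^bsub>V\<^esub> s `` {b} = Some C \<longleftrightarrow> is_sum Q (r `` {a}) (r `` {b}) C" (is "?L \<longleftrightarrow> ?R")
proof -
  have U: "a \<in> carrier U" "b \<in> carrier U" using assms by (auto simp: carrier_U)
  show ?thesis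
  proof
    assume ?L
    then obtain a' b' c where *: "(a, a') \<in> s" "(b, b') \<in> s" "is_sum U a' b' c" "C = s `` {c}"
      unfolding psum_V_eq_Some[OF U] by (elim exE conjE)
    have ab: "(a, a') \<in> r" "(b, b') \<in> r" using *(1,2) assms by (simp_all add: ext_rel_P)
    have c: "is_sum P a' b' c"
      using *(3) rel_closed[OF ab(1)] rel_closed[OF ab(2)] by (simp add: is_sum_U)
    show ?R
      using is_sum_QI[OF c] *(4) ext_rel_class_P[OF is_sum_closed(3)[OF c]]
      unfolding equiv_class_eq[OF equiv ab(1)] equiv_class_eq[OF equiv ab(2)] by simp
  next
    assume ?R
    then obtain a' b' c where *: "is_sum P a' b' c" "r `` {a} = r `` {a'}" "r `` {b} = r `` {b'}"
      "C = r `` {c}" by (rule is_sum_QE)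
    have "(a, a') \<in> s" "(b, b') \<in> s"
      using assms *(2,3) is_sum_closed[OF *(1)] by (simp_all add: ext_rel_P class_eq_iff)
    moreover have "is_sum U a' b' c" "C = s `` {c}"
      using *(1,4) is_sum_closed[OF *(1)] by (simp_all add: is_sum_U ext_rel_class_P)
    ultimately show ?L unfolding psum_V_eq_Some[OF U] by blast
  qed
qed

text \<open>The class of \<open>\<eta> b\<close> consists of the elements \<open>\<eta> b'\<close>
  with \<open>b'\<close> related to \<open>b\<close>. Hence a choice of representatives for the
  mixed sum is the same as one for a sum in \<open>Q\<close> with total the class of
  \<open>b\<close>.\<close>

lemma psum_V_P_eta:
  assumes "a \<in> carrier P" "b \<in> carrier P"
  shows "s `` {a} \<oplus>\<^bsub>V\<^esub> s `` {\<eta> b} = Some C \<longleftrightarrow>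
    (\<exists>D. is_sum Q D (r `` {a}) (r `` {b}) \<and> C = quot_map s \<eta> D)" (is "?L \<longleftrightarrow> ?R")
proof -
  have U: "a \<in> carrier U" "\<eta> b \<in> carrier U" using assms by (auto simp: carrier_U)
  show ?thesis
  proof
    assume ?L
    then obtain a' y z where *: "(a, a') \<in> s" "(\<eta> b, y) \<in> s" "is_sum U a' y z" "C = s `` {z}"
      unfolding psum_V_eq_Some[OF U] by (elim exE conjE)
    obtain b' where y: "y = \<eta> b'" "(b, b') \<in> r"
      using *(2) assms by (auto simp: ext_rel_eta)
    have a: "(a, a') \<in> r" using *(1) assms by (simp add: ext_rel_P)
    obtain d where d: "is_sum P d a' b'" "z = \<eta> d"
      using *(3) rel_closed[OF a] rel_closed[OF y(2)] by (auto simp: y(1) is_sum_U_eta_right)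
    have "is_sum Q (r `` {d}) (r `` {a}) (r `` {b})"
      using is_sum_QI[OF d(1)] equiv_class_eq[OF equiv a] equiv_class_eq[OF equiv y(2)] by simp
    moreover have "C = quot_map s \<eta> (r `` {d})"
      using *(4) d(2) is_sum_closed[OF d(1)] by (simp add: quot_eta_class)
    ultimately show ?R by blast
  next
    assume ?R
    then obtain D where D: "is_sum Q D (r `` {a}) (r `` {b})" "C = quot_map s \<eta> D" by blast
    obtain d a' b' where *: "is_sum P d a' b'" "D = r `` {d}" "r `` {a} = r `` {a'}" "r `` {b} = r `` {b'}"
      using D(1) by (rule is_sum_QE)
    have "(a, a') \<in> s" "(\<eta> b, \<eta> b') \<in> s"
      using assms *(3,4) is_sum_closed[OF *(1)]
      by (simp_all add: ext_rel_P ext_rel_eta_eta class_eq_iff)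
    moreover have "is_sum U a' (\<eta> b') (\<eta> d)" "C = s `` {\<eta> d}"
      using *(1,2) D(2) is_sum_closed[OF *(1)] by (auto simp: is_sum_U_eta_right quot_eta_class)
    ultimately show ?L unfolding psum_V_eq_Some[OF U] by blast
  qed
qed

lemma psum_V_eta_P:
  assumes "a \<in> carrier P" "b \<in> carrier P"
  shows "s `` {\<eta> a} \<oplus>\<^bsub>V\<^esub> s `` {b} = Some C \<longleftrightarrow>
    (\<exists>D. is_sum Q (r `` {\<gamma> b}) D (r `` {a}) \<and> C = quot_map s \<eta> D)" (is "?L \<longleftrightarrow> ?R")
proof -
  have U: "\<eta> a \<in> carrier U" "b \<in> carrier U" using assms by (auto simp: carrier_U)
  show ?thesis
  proof
    assume ?L
    then obtain y b' z where *: "(\<eta> a, y) \<in> s" "(b, b') \<in> s" "is_sum U y b' z" "C = s `` {z}"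
      unfolding psum_V_eq_Some[OF U] by (elim exE conjE)
    obtain a' where y: "y = \<eta> a'" "(a, a') \<in> r"
      using *(1) assms by (auto simp: ext_rel_eta)
    have b: "(b, b') \<in> r" using *(2) assms by (simp add: ext_rel_P)
    then have gb: "(\<gamma> b, \<gamma> b') \<in> r" using rel_closed[OF b] by (simp add: rel_aut)
    obtain d where d: "is_sum P (\<gamma> b') d a'" "z = \<eta> d"
      using *(3) rel_closed[OF b] rel_closed[OF y(2)] by (auto simp: y(1) is_sum_U_eta_left)
    have "is_sum Q (r `` {\<gamma> b}) (r `` {d}) (r `` {a})"
      using is_sum_QI[OF d(1)] equiv_class_eq[OF equiv gb] equiv_class_eq[OF equiv y(2)] by simp
    moreover have "C = quot_map s \<eta> (r `` {d})"
      using *(4) d(2) is_sum_closed[OF d(1)] by (simp add: quot_eta_class)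
    ultimately show ?R by blast
  next
    assume ?R
    then obtain D where D: "is_sum Q (r `` {\<gamma> b}) D (r `` {a})" "C = quot_map s \<eta> D" by blast
    obtain x d a' where *: "is_sum P x d a'" "r `` {\<gamma> b} = r `` {x}" "D = r `` {d}" "r `` {a} = r `` {a'}"
      using D(1) by (rule is_sum_QE)
    \<comment> \<open>The representative \<open>x\<close> of the class of \<open>\<gamma> b\<close>
      must itself be a \<open>\<gamma>\<close>-image before it can enter a sum of \<open>U\<close>;
      \<open>rel_aut\<close> then relates \<open>b'\<close> to \<open>b\<close>.\<close>
    obtain b' where b': "b' \<in> carrier P" "x = \<gamma> b'" using aut_surj[OF is_sum_closed(1)[OF *(1)]] .
    have "(b, b') \<in> s" "(\<eta> a, \<eta> a') \<in> s"
      using assms *(2,4) b' is_sum_closed[OF *(1)]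
      by (simp_all add: ext_rel_P ext_rel_eta_eta class_eq_iff rel_aut aut_closed)
    moreover have "is_sum U (\<eta> a') b' (\<eta> d)" "C = s `` {\<eta> d}"
      using *(1,3) b' D(2) is_sum_closed[OF *(1)] by (auto simp: is_sum_U_eta_left quot_eta_class)
    ultimately show ?L unfolding psum_V_eq_Some[OF U] by blast
  qed
qed

lemma psum_V_eta_eta:
  assumes "a \<in> carrier P" "b \<in> carrier P"
  shows "s `` {\<eta> a} \<oplus>\<^bsub>V\<^esub> s `` {\<eta> b} = None"
proof -
  have U: "\<eta> a \<in> carrier U" "\<eta> b \<in> carrier U" using assms by (auto simp: carrier_U)
  have "s `` {\<eta> a} \<oplus>\<^bsub>V\<^esub> s `` {\<eta> b} \<noteq> Some C" for C
    unfolding psum_V_eq_Some[OF U] using assms rel_closed is_sum_U_eta_eta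
    by (auto simp: ext_rel_eta)
  then show ?thesis by (metis option.exhaust)
qed

text \<open>Each sum axiom is checked on its graph: the descriptions of sums in \<open>V\<close>
  turn into the prescribed differences once these are rewritten as sums in \<open>Q\<close>.\<close>

lemma gamma_unitization_Q: "gamma_unitization Q (quot_map r \<gamma>) (quot_map s \<eta>) V"
proof (intro gamma_unitization.intro gamma_unitization_axioms.intro unitizing_automorphism_Q)
  interpret Q: gpea Q by (rule gpea_Q)
  show "inj_on (quot_map s \<eta>) (carrier Q)"
  proof (rule inj_onI)
    fix A B assume *: "A \<in> carrier Q" "B \<in> carrier Q" "quot_map s \<eta> A = quot_map s \<eta> B"
    obtain a b where ab: "a \<in> carrier P" "A = r `` {a}" "b \<in> carrier P" "B = r `` {b}"
      using * in_Q_E by metis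
    then have "(\<eta> a, \<eta> b) \<in> s"
      using *(3) quot_eta_class eq_equiv_class_iff[OF equiv_ext_rel] eta_in_U by metis
    then show "A = B" using ab ext_rel_eta_eta class_eq_iff by blast
  qed
  show "carrier Q \<inter> quot_map s \<eta> ` carrier Q = {}"
  proof -
    \<comment> \<open>The left class contains \<open>a\<close>, which lies in \<open>P\<close>,
      whereas the right class contains only values of \<open>\<eta>\<close>.\<close>
    have neq: "r `` {a} \<noteq> quot_map s \<eta> (r `` {b})" if h: "a \<in> carrier P" "b \<in> carrier P" for a b
    proof -
      have "a \<in> r `` {a}" using h rel_refl by simp
      moreover have "a \<notin> quot_map s \<eta> (r `` {b})"
        using h rel_closed eta_notin by (auto simp: quot_eta_class ext_rel_eta)
      ultimately show ?thesis by blast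
    qed
    have "A \<noteq> quot_map s \<eta> B" if h: "A \<in> carrier Q" "B \<in> carrier Q" for A B
      by (rule in_Q_E[OF h(1)], rule in_Q_E[OF h(2)]) (simp add: neq)
    then show ?thesis by blast
  qed
  show "carrier V = carrier Q \<union> quot_map s \<eta> ` carrier Q" by (rule carrier_V)
  show "\<zero>\<^bsub>V\<^esub> = \<zero>\<^bsub>Q\<^esub>"
    by (simp add: quot_unital_alg_def quot_alg_def zero_U ext_rel_class_P zero_closed)
  show "\<one>\<^bsub>V\<^esub> = quot_map s \<eta> \<zero>\<^bsub>Q\<^esub>"
    by (simp add: quot_unital_alg_def quot_alg_def one_U quot_eta_class zero_closed)
  fix A B assume AB: "A \<in> carrier Q" "B \<in> carrier Q"
  obtain a b where ab: "a \<in> carrier P" "A = r `` {a}" "b \<in> carrier P" "B = r `` {b}"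
    using AB in_Q_E by metis
  have A: "A = s `` {a}" "quot_map s \<eta> A = s `` {\<eta> a}" and B: "B = s `` {b}" "quot_map s \<eta> B = s `` {\<eta> b}"
    using ab ext_rel_class_P quot_eta_class by auto
  show "A \<oplus>\<^bsub>V\<^esub> B = A \<oplus>\<^bsub>Q\<^esub> B"
  proof (rule option_eqI)
    fix C
    show "A \<oplus>\<^bsub>V\<^esub> B = Some C \<longleftrightarrow> A \<oplus>\<^bsub>Q\<^esub> B = Some C"
      using psum_V_P_P[OF ab(1,3), of C] AB unfolding A(1)[symmetric] B(1)[symmetric]
      by (simp add: is_sum_def ab(2,4)[symmetric])
  qed
  show "A \<oplus>\<^bsub>V\<^esub> quot_map s \<eta> B =
    (if A \<preceq>\<^bsub>Q\<^esub> B then Some (quot_map s \<eta> (rdiff Q B A)) else None)"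
  proof (rule option_eqI)
    fix C
    show "A \<oplus>\<^bsub>V\<^esub> quot_map s \<eta> B = Some C \<longleftrightarrow>
      (if A \<preceq>\<^bsub>Q\<^esub> B then Some (quot_map s \<eta> (rdiff Q B A)) else None) = Some C"
      using psum_V_P_eta[OF ab(1,3), of C]
      unfolding Q.if_ple_rdiff_eq_Some[OF AB(1)] A(1)[symmetric] B(2)[symmetric] ab(2,4)[symmetric] .
  qed
  show "quot_map s \<eta> A \<oplus>\<^bsub>V\<^esub> B = (if quot_map r \<gamma> B \<preceq>\<^bsub>Q\<^esub> A
    then Some (quot_map s \<eta> (ldiff Q (quot_map r \<gamma> B) A)) else None)"
  proof (rule option_eqI)
    fix C
    have "quot_map r \<gamma> B = r `` {\<gamma> b}" using ab by (simp add: quot_aut_class)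
    then show "quot_map s \<eta> A \<oplus>\<^bsub>V\<^esub> B = Some C \<longleftrightarrow> (if quot_map r \<gamma> B \<preceq>\<^bsub>Q\<^esub> A
      then Some (quot_map s \<eta> (ldiff Q (quot_map r \<gamma> B) A)) else None) = Some C"
      using psum_V_eta_P[OF ab(1,3), of C]
      unfolding Q.if_ple_ldiff_eq_Some[OF quot_aut_closed[OF AB(2)]]
        A(2)[symmetric] B(1)[symmetric] ab(2)[symmetric] by simp
  qed
  show "quot_map s \<eta> A \<oplus>\<^bsub>V\<^esub> quot_map s \<eta> B = None"
    unfolding A(2) B(2) by (rule psum_V_eta_eta[OF ab(1,3)])
qed

end

section \<open>Normal Riesz ideals\<close>

locale normal_riesz = gpea P for P :: "('a, 'm) partial_alg_scheme" (structure) +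
  fixes I :: "'a set"
  assumes normal: "normal_ideal P I" and riesz: "riesz_ideal P I"
begin

section \<open>Moving, splitting and bounding ideal elements\<close>

lemma ideal: "pa_ideal P I"
  using normal by (simp add: normal_ideal_def)

lemma ideal_closed: "i \<in> I \<Longrightarrow> i \<in> carrier P"
  using ideal unfolding pa_ideal_def by blast

lemma ideal_sum: "is_sum P i j k \<Longrightarrow> i \<in> I \<Longrightarrow> j \<in> I \<Longrightarrow> k \<in> I"
  using ideal unfolding pa_ideal_def is_sum_def by blast

lemma ideal_ple: "i \<in> I \<Longrightarrow> a \<in> carrier P \<Longrightarrow> a \<preceq> i \<Longrightarrow> a \<in> I"
  using ideal unfolding pa_ideal_def by blast

lemma ideal_summands:
  assumes "is_sum P a b i" "i \<in> I"
  shows "a \<in> I" "b \<in> I"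
  using assms ideal_ple ple_iff_left ple_iff_right is_sum_closed by metis+

lemma ideal_zero: "\<zero> \<in> I"
proof -
  obtain i where "i \<in> I" using ideal unfolding pa_ideal_def by blast
  then show ?thesis using is_sum_zero_left ideal_closed ideal_summands by blast
qed

text \<open>Conjugation supplies the element \<open>j\<close> on the other side, and normality puts
  it into \<open>I\<close>.\<close>

lemma ideal_move_left:
  assumes "is_sum P c i a" "i \<in> I"
  obtains j where "is_sum P j c a" "j \<in> I"
proof -
  obtain j where j: "is_sum P j c a" using is_sum_conjugate assms by blast
  then have "j \<in> I" using normal assms unfolding normal_ideal_def is_sum_def by blast
  with j that show thesis by blast
qed

lemma ideal_move_right:
  assumes "is_sum P i c a" "i \<in> I"
  obtains j where "is_sum P c j a" "j \<in> I"
proof -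
  obtain j where j: "is_sum P c j a" using is_sum_conjugate assms by blast
  then have "j \<in> I" using normal assms unfolding normal_ideal_def is_sum_def by blast
  with j that show thesis by blast
qed

lemma riesz_R1:
  assumes "i \<in> I" "is_sum P a b c" "i \<preceq> c"
  obtains j k m where "j \<in> I" "k \<in> I" "j \<preceq> a" "k \<preceq> b" "is_sum P j k m" "i \<preceq> m"
proof -
  have "\<exists>j\<in>I. \<exists>k\<in>I. \<exists>m. j \<preceq> a \<and> k \<preceq> b \<and> j \<oplus> k = Some m \<and> i \<preceq> m"
    using assms riesz unfolding riesz_ideal_def is_sum_def by blast
  then show thesis using that ideal_closed unfolding is_sum_def by blast
qed

text \<open>The differences in (R2) become witnesses: \<open>x\<close> is \<open>rdiff P a i\<close>
  and \<open>b'\<close> is \<open>ldiff P j b\<close>.\<close>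

lemma riesz_R2_left:
  assumes "i \<in> I" "is_sum P x i a" "is_sum P x b c"
  obtains j b' d where "j \<in> I" "is_sum P j b' b" "is_sum P a b' d"
proof -
  have ab: "a \<in> carrier P" "b \<in> carrier P"
    using is_sum_closed(3)[OF assms(2)] is_sum_closed(2)[OF assms(3)] .
  have "i \<preceq> a" unfolding ple_iff_left[OF ideal_closed[OF assms(1)]] using assms(2) by (rule exI)
  moreover have "rdiff P a i \<oplus> b \<noteq> None"
    using assms(3) by (simp add: rdiff_eq[OF assms(2)] is_sum_def)
  ultimately have "\<exists>j\<in>I. j \<preceq> b \<and> a \<oplus> ldiff P j b \<noteq> None"
    using riesz assms(1) ab unfolding riesz_ideal_def by blast
  then obtain j where j: "j \<in> I" "j \<preceq> b" "a \<oplus> ldiff P j b \<noteq> None" by blast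
  then obtain b' where b': "is_sum P j b' b" using ple_iff_right[OF ideal_closed] by blast
  then obtain d where "is_sum P a b' d"
    using j(3) ab is_sum_closed(2)[OF b'] by (auto simp: ldiff_eq[OF b'] is_sum_def)
  with j(1) b' show thesis by (rule that)
qed

lemma riesz_R2_right:
  assumes "i \<in> I" "is_sum P i x a" "is_sum P b x c"
  obtains k b' d where "k \<in> I" "is_sum P b' k b" "is_sum P b' a d"
proof -
  have ab: "a \<in> carrier P" "b \<in> carrier P"
    using is_sum_closed(3)[OF assms(2)] is_sum_closed(1)[OF assms(3)] .
  have "i \<preceq> a" unfolding ple_iff_right[OF ideal_closed[OF assms(1)]] using assms(2) by (rule exI)
  moreover have "b \<oplus> ldiff P i a \<noteq> None"
    using assms(3) by (simp add: ldiff_eq[OF assms(2)] is_sum_def)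
  ultimately have "\<exists>k\<in>I. k \<preceq> b \<and> rdiff P b k \<oplus> a \<noteq> None"
    using riesz assms(1) ab unfolding riesz_ideal_def by blast
  then obtain k where k: "k \<in> I" "k \<preceq> b" "rdiff P b k \<oplus> a \<noteq> None" by blast
  then obtain b' where b': "is_sum P b' k b" using ple_iff_left[OF ideal_closed] by blast
  then obtain d where "is_sum P b' a d"
    using k(3) ab is_sum_closed(1)[OF b'] by (auto simp: rdiff_eq[OF b'] is_sum_def)
  with k(1) b' show thesis by (rule that)
qed

text \<open>By (R1) the ideal elements \<open>i\<close> and \<open>j\<close> below \<open>a\<close>
  have a common upper bound \<open>n\<close> in \<open>I\<close> that is still below
  \<open>a\<close>. Removing \<open>n\<close> from \<open>a\<close> gives an element
  \<open>z\<close> from which both \<open>x\<close> and \<open>y\<close> arise by adding ideal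
  elements.\<close>

lemma ideal_directed:
  assumes "i \<in> I" "j \<in> I" "is_sum P x i a" "is_sum P y j a"
  obtains z i' j' where "i' \<in> I" "j' \<in> I" "is_sum P z i' x" "is_sum P z j' y"
proof -
  have "j \<preceq> a" using assms ple_iff_left is_sum_closed by blast
  then obtain k l m where k: "k \<in> I" "l \<in> I" "k \<preceq> x" "l \<preceq> i" "is_sum P k l m" "j \<preceq> m"
    using riesz_R1[OF assms(2,3)] by metis
  obtain z where z: "is_sum P z k x" using k ple_iff_left ideal_closed by blast
  \<comment> \<open>The bound is \<open>n\<close>, the sum of \<open>k\<close> and \<open>i\<close>.
    It ends in \<open>i\<close> by construction and lies above \<open>j\<close> by the next
    steps.\<close>
  obtain n where n: "is_sum P k i n" "is_sum P z n a" using z assms(3) is_sum_assoc_right by blast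
  obtain l' where "is_sum P l l' i" using k ple_iff_right ideal_closed by blast
  \<comment> \<open>Writing \<open>i\<close> as \<open>l\<close> plus \<open>l'\<close> exhibits
    \<open>n\<close> as \<open>m\<close> plus \<open>l'\<close>.\<close>
  then have "m \<preceq> n" using k(5) n(1) is_sum_assoc_left ple_iff_right is_sum_closed is_sum_unique by metis
  then have "j \<preceq> n" using k(6) ple_trans ideal_closed assms(2) by blast
  then obtain j' where j': "is_sum P j' j n" using ple_iff_left ideal_closed assms(2) by blast
  have "n \<in> I" using n(1) k(1) assms(1) ideal_sum by blast
  then have "j' \<in> I" using j' ideal_summands by blast
  \<comment> \<open>Both \<open>z\<close> plus \<open>j'\<close> and \<open>y\<close> give
    \<open>a\<close> when \<open>j\<close> is added on the right, so they are equal.\<close>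
  moreover have "is_sum P z j' y"
    using is_sum_assoc_left[OF j' n(2)] assms(4) is_sum_right_cancel by metis
  ultimately show thesis using that k(1) z by blast
qed

section \<open>The relation of an ideal: congruence and decomposition\<close>

lemma ideal_rel_iff:
  "(a, b) \<in> ideal_rel P I \<longleftrightarrow> (\<exists>x. \<exists>i\<in>I. \<exists>j\<in>I. is_sum P x i a \<and> is_sum P x j b)" (is "?L \<longleftrightarrow> ?R")
proof
  assume ?L
  then obtain i j where "i \<in> I" "j \<in> I" "i \<preceq> a" "j \<preceq> b" "rdiff P a i = rdiff P b j"
    unfolding ideal_rel_def by blast
  then show ?R using ple_iff_left rdiff_eq ideal_closed by metis
next
  assume ?R
  then obtain x i j where *: "i \<in> I" "j \<in> I" "is_sum P x i a" "is_sum P x j b" by blast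
  then have "i \<preceq> a" "j \<preceq> b" "rdiff P a i = rdiff P b j" "a \<in> carrier P" "b \<in> carrier P"
    using ple_iff_left is_sum_closed rdiff_eq by metis+
  with * show ?L unfolding ideal_rel_def by blast
qed

text \<open>Normality moves both ideal parts across the same \<open>x\<close>. Having both forms
  allows the ideal parts of two summands to be brought next to each other.\<close>

lemma ideal_rel_iff_left:
  "(a, b) \<in> ideal_rel P I \<longleftrightarrow> (\<exists>x. \<exists>i\<in>I. \<exists>j\<in>I. is_sum P i x a \<and> is_sum P j x b)"
  unfolding ideal_rel_iff using ideal_move_left ideal_move_right by metis

text \<open>The common difference is \<open>a\<close> itself, with ideal parts
  \<open>\<zero>\<close> and \<open>i\<close>.\<close>

lemma ideal_rel_add_right: "is_sum P a i b \<Longrightarrow> i \<in> I \<Longrightarrow> (a, b) \<in> ideal_rel P I"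
  unfolding ideal_rel_iff using is_sum_zero_right is_sum_closed ideal_zero by blast

lemma ideal_rel_add_left: "is_sum P i a b \<Longrightarrow> i \<in> I \<Longrightarrow> (a, b) \<in> ideal_rel P I"
  using ideal_move_right ideal_rel_add_right by metis

lemma equiv_ideal_rel: "equiv (carrier P) (ideal_rel P I)"
proof (rule equivI)
  show "ideal_rel P I \<subseteq> carrier P \<times> carrier P" by (auto simp: ideal_rel_def)
  show "refl_on (carrier P) (ideal_rel P I)"
    using ideal_rel_add_right[OF is_sum_zero_right ideal_zero] by (auto simp: refl_on_def)
  show "sym (ideal_rel P I)" unfolding sym_def ideal_rel_iff by blast
  show "trans (ideal_rel P I)"
  proof (rule transI)
    fix a b c assume "(a, b) \<in> ideal_rel P I" "(b, c) \<in> ideal_rel P I"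
    then obtain x i j y k l where i: "i \<in> I" "j \<in> I" "k \<in> I" "l \<in> I"
      and s: "is_sum P x i a" "is_sum P x j b" "is_sum P y k b" "is_sum P y l c"
      unfolding ideal_rel_iff by blast
    \<comment> \<open>The two decompositions of \<open>b\<close> have different cores
      \<open>x\<close> and \<open>y\<close>; directedness provides a common core \<open>z\<close>
      below both.\<close>
    obtain z u v where z: "u \<in> I" "v \<in> I" "is_sum P z u x" "is_sum P z v y"
      using ideal_directed[OF i(2,3) s(2,3)] .
    obtain m where "is_sum P u i m" "is_sum P z m a" using is_sum_assoc_right[OF z(3) s(1)] .
    moreover obtain n where "is_sum P v l n" "is_sum P z n c" using is_sum_assoc_right[OF z(4) s(4)] .
    ultimately show "(a, c) \<in> ideal_rel P I" unfolding ideal_rel_iff using ideal_sum i z by meson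
  qed
qed

lemma ideal_rel_sym: "(a, b) \<in> ideal_rel P I \<Longrightarrow> (b, a) \<in> ideal_rel P I"
  using equiv_ideal_rel by (meson equivE symE)

lemma ideal_rel_trans: "(a, b) \<in> ideal_rel P I \<Longrightarrow> (b, c) \<in> ideal_rel P I \<Longrightarrow> (a, c) \<in> ideal_rel P I"
  using equiv_ideal_rel by (meson equivE transE)

text \<open>In \<open>x + i + j + y\<close> the middle part \<open>i + j\<close> belongs to
  \<open>I\<close> and can be moved to the far right. The core \<open>d\<close> depends only on
  \<open>x\<close> and \<open>y\<close>. With a zero ideal part the lemma also yields existence of a
  sum after trimming one summand.\<close>

lemma sum_with_ideal_parts:
  assumes "is_sum P x i a" "is_sum P j y b" "is_sum P a b c" "i \<in> I" "j \<in> I"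
  obtains d k where "is_sum P x y d" "is_sum P d k c" "k \<in> I"
proof -
  obtain f where f: "is_sum P i b f" "is_sum P x f c" using is_sum_assoc_right[OF assms(1,3)] .
  obtain k where k: "is_sum P i j k" "is_sum P k y f" using is_sum_assoc_left[OF assms(2) f(1)] .
  obtain k' where k': "is_sum P y k' f" "k' \<in> I"
    using ideal_move_right[OF k(2)] ideal_sum[OF k(1) assms(4,5)] by blast
  obtain d where "is_sum P x y d" "is_sum P d k' c" using is_sum_assoc_left[OF k'(1) f(2)] .
  with k' that show thesis by blast
qed

lemma ideal_rel_is_sum:
  assumes "(a, a') \<in> ideal_rel P I" "(b, b') \<in> ideal_rel P I" "is_sum P a b c" "is_sum P a' b' c'"
  shows "(c, c') \<in> ideal_rel P I"
proof -
  obtain x i i' where x: "i \<in> I" "i' \<in> I" "is_sum P x i a" "is_sum P x i' a'"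
    using assms(1) ideal_rel_iff by blast
  obtain y j j' where y: "j \<in> I" "j' \<in> I" "is_sum P j y b" "is_sum P j' y b'"
    using assms(2) ideal_rel_iff_left by blast
  obtain d k where "is_sum P x y d" "is_sum P d k c" "k \<in> I"
    using sum_with_ideal_parts[OF x(3) y(3) assms(3) x(1) y(1)] .
  moreover obtain d' k' where "is_sum P x y d'" "is_sum P d' k' c'" "k' \<in> I"
    using sum_with_ideal_parts[OF x(4) y(4) assms(4) x(2) y(2)] .
  \<comment> \<open>The cores \<open>d\<close> and \<open>d'\<close> are both the sum of
    \<open>x\<close> and \<open>y\<close>, so \<open>c\<close> and \<open>c'\<close> share a
    core.\<close>
  ultimately show ?thesis unfolding ideal_rel_iff using is_sum_unique by metis
qed

text \<open>First \<open>a\<close> is trimmed to the core \<open>x\<close> that it shares with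
  \<open>a'\<close>, and \<open>x + b\<close> still exists. Then (R2) restores the ideal part of
  \<open>a'\<close> at the cost of an ideal part of \<open>b\<close>.\<close>

lemma ideal_rel_C3_left:
  assumes "is_sum P a b c" "(a', a) \<in> ideal_rel P I"
  shows "\<exists>b' c'. (b', b) \<in> ideal_rel P I \<and> is_sum P a' b' c'"
proof -
  obtain x i i' where x: "i \<in> I" "i' \<in> I" "is_sum P x i a" "is_sum P x i' a'"
    using assms(2) ideal_rel_iff by blast
  obtain d where "is_sum P x b d"
    using sum_with_ideal_parts[OF x(3) is_sum_zero_left assms(1) x(1) ideal_zero] is_sum_closed[OF assms(1)]
    by blast
  then obtain j b' e where "j \<in> I" "is_sum P j b' b" "is_sum P a' b' e"
    using riesz_R2_left[OF x(2,4)] by metis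
  then show ?thesis using ideal_rel_add_left by blast
qed

lemma ideal_rel_C3_right:
  assumes "is_sum P a b c" "(b', b) \<in> ideal_rel P I"
  shows "\<exists>a' c'. (a', a) \<in> ideal_rel P I \<and> is_sum P a' b' c'"
proof -
  obtain y i i' where y: "i \<in> I" "i' \<in> I" "is_sum P i y b" "is_sum P i' y b'"
    using assms(2) ideal_rel_iff_left by blast
  obtain d where "is_sum P a y d"
    using sum_with_ideal_parts[OF is_sum_zero_right y(3) assms(1) ideal_zero y(1)] is_sum_closed[OF assms(1)]
    by blast
  then obtain k a' e where "k \<in> I" "is_sum P a' k a" "is_sum P a' b' e"
    using riesz_R2_right[OF y(2,4)] by metis
  then show ?thesis using ideal_rel_add_right by blast
qed

lemma congruence_ideal_rel: "congruence P (ideal_rel P I)"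
proof -
  note closed = equiv_type[OF equiv_ideal_rel]
  show ?thesis unfolding congruence_def
  proof (intro conjI allI ballI impI equiv_ideal_rel)
    fix a a' b b' c c'
    assume "(a, a') \<in> ideal_rel P I" "(b, b') \<in> ideal_rel P I" "a \<oplus> b = Some c" "a' \<oplus> b' = Some c'"
    then show "(c, c') \<in> ideal_rel P I"
      using ideal_rel_is_sum closed unfolding is_sum_def by blast
  next
    fix a b a' assume "a \<in> carrier P" "b \<in> carrier P" "a \<oplus> b \<noteq> None" "(a', a) \<in> ideal_rel P I"
    then show "\<exists>b'. (b', b) \<in> ideal_rel P I \<and> a' \<oplus> b' \<noteq> None"
      using ideal_rel_C3_left unfolding is_sum_def by blast
  next
    fix a b b' assume "a \<in> carrier P" "b \<in> carrier P" "a \<oplus> b \<noteq> None" "(b', b) \<in> ideal_rel P I"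
    then show "\<exists>a'. (a', a) \<in> ideal_rel P I \<and> a' \<oplus> b' \<noteq> None"
      using ideal_rel_C3_right unfolding is_sum_def by blast
  qed
qed

text \<open>The elements \<open>a\<close> and \<open>d\<close> share a core \<open>e\<close>. The
  splitting of \<open>d\<close> is modified within its classes until \<open>j\<close> can be removed
  from the second summand; this splits \<open>e\<close>, and adding \<open>i\<close> to the second
  part then splits \<open>a\<close>.\<close>

lemma C5'_ideal_rel: "cond_C5' P (ideal_rel P I)"
  unfolding cond_C5'_def
proof (intro ballI allI impI)
  fix a b c d
  assume *: "a \<in> carrier P" "b \<in> carrier P" "c \<in> carrier P" "b \<oplus> c = Some d" "(a, d) \<in> ideal_rel P I"
  then have d: "is_sum P b c d" by (simp add: is_sum_def)
  obtain e i j where e: "i \<in> I" "j \<in> I" "is_sum P e i a" "is_sum P e j d"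
    using *(5) ideal_rel_iff by blast
  then have "j \<preceq> d" using ple_iff_left is_sum_closed by blast
  then obtain k l m where k: "k \<in> I" "l \<in> I" "k \<preceq> b" "l \<preceq> c" "is_sum P k l m" "j \<preceq> m"
    using riesz_R1[OF e(2) d] by metis
  obtain b1 where b1: "is_sum P b1 k b" using k ple_iff_left ideal_closed by blast
  \<comment> \<open>Shifting \<open>k\<close> from \<open>b\<close> to \<open>c\<close> puts all of \<open>j\<close> below the second summand.\<close>
  obtain c1 where c1: "is_sum P k c c1" "is_sum P b1 c1 d" using is_sum_assoc_right[OF b1 d] .
  obtain l' where "is_sum P l l' c" using k ple_iff_right ideal_closed by blast
  then have "m \<preceq> c1"
    using k(5) c1(1) is_sum_assoc_left ple_iff_right is_sum_closed is_sum_unique by metis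
  then have "j \<preceq> c1" using k(6) ple_trans ideal_closed e(2) by blast
  then obtain c2 where c2: "is_sum P c2 j c1" using ple_iff_left ideal_closed e(2) by blast
  \<comment> \<open>Reassociation gives \<open>d\<close> as \<open>b1 + c2\<close> followed by
    \<open>j\<close>; cancelling \<open>j\<close> against \<open>e + j\<close> identifies
    \<open>b1 + c2\<close> with \<open>e\<close>.\<close>
  have "is_sum P b1 c2 e" using is_sum_assoc_left[OF c2 c1(2)] e(4) is_sum_right_cancel by metis
  then obtain c3 where c3: "is_sum P c2 i c3" "is_sum P b1 c3 a"
    using is_sum_assoc_right e(3) by metis
  have "(b1, b) \<in> ideal_rel P I" using b1 k(1) ideal_rel_add_right by blast
  \<comment> \<open>The chain is \<open>c3\<close>, \<open>c2\<close>, \<open>c1\<close>,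
    \<open>c\<close>, where neighbours differ by \<open>i\<close>, \<open>j\<close> and
    \<open>k\<close> respectively.\<close>
  moreover have "(c3, c) \<in> ideal_rel P I"
    using ideal_rel_add_right[OF c3(1) e(1)] ideal_rel_add_right[OF c2 e(2)]
      ideal_rel_add_left[OF c1(1) k(1)] ideal_rel_sym ideal_rel_trans by metis
  ultimately show "\<exists>a1 a2. (a1, b) \<in> ideal_rel P I \<and> (a2, c) \<in> ideal_rel P I \<and> a1 \<oplus> a2 = Some a"
    using c3(2) unfolding is_sum_def by blast
qed

section \<open>Cancellation modulo the ideal\<close>

lemma ideal_rel_of_common_upper:
  assumes "i \<in> I" "j \<in> I" "is_sum P p i m" "is_sum P q j m"
  shows "(p, q) \<in> ideal_rel P I"
  using ideal_directed[OF assms] ideal_rel_iff by metis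

lemma GCR_left:
  assumes "cond_GCR P I" "(a, b) \<in> ideal_rel P I"
  obtains i j c where "i \<in> I" "j \<in> I" "is_sum P i a c" "is_sum P j b c"
  using assms ideal_closed unfolding cond_GCR_def is_sum_def ideal_rel_def by blast

text \<open>(GCR) adds ideal elements to \<open>c\<close> and \<open>d\<close> on the left, where
  \<open>x\<close> stands. Moving them to the right puts them next to \<open>p\<close> and
  \<open>q\<close>, so exact cancellation of \<open>x\<close> leaves \<open>p\<close> and
  \<open>q\<close> with a common upper bound modulo \<open>I\<close>.\<close>

lemma GCR_cancel_left:
  assumes "cond_GCR P I" "is_sum P x p c" "is_sum P x q d" "(c, d) \<in> ideal_rel P I"
  shows "(p, q) \<in> ideal_rel P I"
proof -
  obtain i j e where "i \<in> I" "j \<in> I" "is_sum P i c e" "is_sum P j d e"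
    using GCR_left[OF assms(1,4)] .
  then obtain i j where ij: "i \<in> I" "j \<in> I" "is_sum P c i e" "is_sum P d j e"
    using ideal_move_right by metis
  obtain m where m: "is_sum P p i m" "is_sum P x m e" using is_sum_assoc_right[OF assms(2) ij(3)] .
  obtain n where n: "is_sum P q j n" "is_sum P x n e" using is_sum_assoc_right[OF assms(3) ij(4)] .
  have "m = n" using m n is_sum_left_cancel by blast
  then show ?thesis using ideal_rel_of_common_upper ij m n by blast
qed

text \<open>Here the elements from (GCR) already stand next to \<open>p\<close> and
  \<open>q\<close>, so \<open>x\<close> is cancelled first and the ideal elements are moved only
  afterwards.\<close>

lemma GCR_cancel_right:
  assumes "cond_GCR P I" "is_sum P p x c" "is_sum P q x d" "(c, d) \<in> ideal_rel P I"
  shows "(p, q) \<in> ideal_rel P I"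
proof -
  obtain i j e where ij: "i \<in> I" "j \<in> I" "is_sum P i c e" "is_sum P j d e"
    using GCR_left[OF assms(1,4)] .
  obtain m where m: "is_sum P i p m" "is_sum P m x e" using is_sum_assoc_left[OF assms(2) ij(3)] .
  obtain n where n: "is_sum P j q n" "is_sum P n x e" using is_sum_assoc_left[OF assms(3) ij(4)] .
  have "m = n" using m n is_sum_right_cancel by blast
  then show ?thesis using ideal_rel_of_common_upper ij m n ideal_move_right by metis
qed

text \<open>The related summands are replaced by their common core \<open>x\<close>, while their
  ideal parts are absorbed into \<open>a'\<close> and \<open>b'\<close> without changing the classes
  of these. Cancellation of the identical summand \<open>x\<close> then suffices.\<close>

lemma C4_ideal_rel:
  assumes "cond_GCR P I"
  shows "cond_C4 P (ideal_rel P I)"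
proof -
  have left: "(a', b') \<in> ideal_rel P I"
    if h: "(a, b) \<in> ideal_rel P I" "is_sum P a a' c" "is_sum P b b' d" "(c, d) \<in> ideal_rel P I"
    for a b a' b' c d
  proof -
    obtain x i j where x: "i \<in> I" "j \<in> I" "is_sum P x i a" "is_sum P x j b"
      using h(1) ideal_rel_iff by blast
    obtain p where p: "is_sum P i a' p" "is_sum P x p c" using is_sum_assoc_right[OF x(3) h(2)] .
    obtain q where q: "is_sum P j b' q" "is_sum P x q d" using is_sum_assoc_right[OF x(4) h(3)] .
    have "(p, q) \<in> ideal_rel P I" using GCR_cancel_left[OF assms p(2) q(2) h(4)] .
    then show ?thesis
      using ideal_rel_add_left[OF p(1) x(1)] ideal_rel_add_left[OF q(1) x(2)]
        ideal_rel_sym ideal_rel_trans by metis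
  qed
  have right: "(a', b') \<in> ideal_rel P I"
    if h: "(a, b) \<in> ideal_rel P I" "is_sum P a' a c" "is_sum P b' b d" "(c, d) \<in> ideal_rel P I"
    for a b a' b' c d
  proof -
    obtain x i j where x: "i \<in> I" "j \<in> I" "is_sum P i x a" "is_sum P j x b"
      using h(1) ideal_rel_iff_left by blast
    obtain p where p: "is_sum P a' i p" "is_sum P p x c" using is_sum_assoc_left[OF x(3) h(2)] .
    obtain q where q: "is_sum P b' j q" "is_sum P q x d" using is_sum_assoc_left[OF x(4) h(3)] .
    have "(p, q) \<in> ideal_rel P I" using GCR_cancel_right[OF assms p(2) q(2) h(4)] .
    then show ?thesis
      using ideal_rel_add_right[OF p(1) x(1)] ideal_rel_add_right[OF q(1) x(2)]
        ideal_rel_sym ideal_rel_trans by metis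
  qed
  show ?thesis unfolding cond_C4_def using left right unfolding is_sum_def by blast
qed

end

section \<open>Compatibility with the automorphism, and assembly\<close>

lemma gamma_congruence_ideal_rel:
  assumes "unitizing_automorphism P \<gamma>" "normal_ideal P I" "riesz_ideal P I" "gamma_ideal P \<gamma> I"
  shows "gamma_congruence P \<gamma> (ideal_rel P I)"
proof -
  interpret unitizing_automorphism P \<gamma> by fact
  interpret normal_riesz P I by unfold_locales fact+
  have I: "a \<in> I \<longleftrightarrow> \<gamma> a \<in> I" if "a \<in> carrier P" for a
    using that assms(4) by (simp add: gamma_ideal_def)
  have "(a, b) \<in> ideal_rel P I \<longleftrightarrow> (\<gamma> a, \<gamma> b) \<in> ideal_rel P I"
    if ab: "a \<in> carrier P" "b \<in> carrier P" for a b
  proof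
    assume "(a, b) \<in> ideal_rel P I"
    then obtain x i j where *: "i \<in> I" "j \<in> I" "is_sum P x i a" "is_sum P x j b"
      using ideal_rel_iff by blast
    have "\<gamma> i \<in> I" "\<gamma> j \<in> I" using *(1,2) I ideal_closed by blast+
    moreover have "is_sum P (\<gamma> x) (\<gamma> i) (\<gamma> a)" "is_sum P (\<gamma> x) (\<gamma> j) (\<gamma> b)"
      using *(3,4) is_sum_closed[OF *(3)] is_sum_closed[OF *(4)] by (simp_all add: aut_is_sum)
    ultimately show "(\<gamma> a, \<gamma> b) \<in> ideal_rel P I" using ideal_rel_iff by blast
  next
    assume "(\<gamma> a, \<gamma> b) \<in> ideal_rel P I"
    then obtain x i j where *: "i \<in> I" "j \<in> I" "is_sum P x i (\<gamma> a)" "is_sum P x j (\<gamma> b)"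
      using ideal_rel_iff by blast
    \<comment> \<open>The whole decomposition is pulled back along \<open>\<gamma>\<close>; its
      ideal parts stay in \<open>I\<close> because membership is reflected as well.\<close>
    then obtain x' i' j' where c: "x' \<in> carrier P" "i' \<in> carrier P" "j' \<in> carrier P"
      and "x = \<gamma> x'" "i = \<gamma> i'" "j = \<gamma> j'"
      using is_sum_closed aut_surj by metis
    then have "i' \<in> I" "j' \<in> I" "is_sum P x' i' a" "is_sum P x' j' b"
      using * I aut_is_sum ab by auto
    then show "(a, b) \<in> ideal_rel P I" using ideal_rel_iff by blast
  qed
  then show ?thesis by (simp add: gamma_congruence_def congruence_ideal_rel)
qed

lemma quotient_unitizationI:
  assumes "gamma_congruence P \<gamma> r" "cond_C4 P r" "cond_C5' P r" "gamma_unitization P \<gamma> \<eta> U"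
  shows "quotient_unitization P r \<gamma> \<eta> U"
proof -
  interpret gamma_unitization P \<gamma> \<eta> U by fact
  show ?thesis
    using assms(1-3) by unfold_locales (auto simp: gamma_congruence_def)
qed

theorem theorem4p22:
  fixes P :: "'a partial_alg" and \<gamma> \<eta> :: "'a \<Rightarrow> 'a" and U :: "'a unital_partial_alg"
  assumes "gpea P"
    and "unitizing_automorphism P \<gamma>"
    and "gamma_unitization P \<gamma> \<eta> U"
  shows "(\<forall>r. gamma_congruence P \<gamma> r \<longrightarrow> cond_C4 P r \<longrightarrow> cond_C5' P r \<longrightarrow>
            (\<forall>a\<in>carrier P. quot_map r \<gamma> (r `` {a}) = r `` {\<gamma> a}) \<and>
            unitizing_automorphism (quot_alg P r) (quot_map r \<gamma>) \<and>
            (\<forall>a\<in>carrier P. quot_map (ext_rel \<eta> r) \<eta> (r `` {a}) = ext_rel \<eta> r `` {\<eta> a}) \<and>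
            gamma_unitization (quot_alg P r) (quot_map r \<gamma>) (quot_map (ext_rel \<eta> r) \<eta>)
              (quot_unital_alg U (ext_rel \<eta> r)))
       \<and> (\<forall>I. normal_ideal P I \<longrightarrow> riesz_ideal P I \<longrightarrow> gamma_ideal P \<gamma> I \<longrightarrow> cond_GCR P I \<longrightarrow>
            (let r = ideal_rel P I in
              (\<forall>a\<in>carrier P. quot_map r \<gamma> (r `` {a}) = r `` {\<gamma> a}) \<and>
              unitizing_automorphism (quot_alg P r) (quot_map r \<gamma>) \<and>
              (\<forall>a\<in>carrier P. quot_map (ext_rel \<eta> r) \<eta> (r `` {a}) = ext_rel \<eta> r `` {\<eta> a}) \<and>
              gamma_unitization (quot_alg P r) (quot_map r \<gamma>) (quot_map (ext_rel \<eta> r) \<eta>)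
                (quot_unital_alg U (ext_rel \<eta> r))))"
proof -
  have main: "(\<forall>a\<in>carrier P. quot_map r \<gamma> (r `` {a}) = r `` {\<gamma> a}) \<and>
    unitizing_automorphism (quot_alg P r) (quot_map r \<gamma>) \<and>
    (\<forall>a\<in>carrier P. quot_map (ext_rel \<eta> r) \<eta> (r `` {a}) = ext_rel \<eta> r `` {\<eta> a}) \<and>
    gamma_unitization (quot_alg P r) (quot_map r \<gamma>) (quot_map (ext_rel \<eta> r) \<eta>)
      (quot_unital_alg U (ext_rel \<eta> r))"
    if r: "gamma_congruence P \<gamma> r" "cond_C4 P r" "cond_C5' P r" for r
  proof -
    interpret quotient_unitization P r \<gamma> \<eta> U
      using quotient_unitizationI[OF r assms(3)] .
    show ?thesis
      using quot_aut_class quot_eta_class unitizing_automorphism_Q gamma_unitization_Q by blast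
  qed
  \<comment> \<open>The ideal case is the general statement for \<open>ideal_rel P I\<close>, where
    (GCR) enters through (C4).\<close>
  have "gamma_congruence P \<gamma> (ideal_rel P I) \<and> cond_C4 P (ideal_rel P I) \<and> cond_C5' P (ideal_rel P I)"
    if I: "normal_ideal P I" "riesz_ideal P I" "gamma_ideal P \<gamma> I" "cond_GCR P I" for I
  proof -
    interpret normal_riesz P I
      using assms(1) I by (intro normal_riesz.intro normal_riesz_axioms.intro)
    show ?thesis
      using gamma_congruence_ideal_rel[OF assms(2) I(1-3)] C4_ideal_rel[OF I(4)] C5'_ideal_rel by blast
  qed
  with main show ?thesis unfolding Let_def by blast
qed

end
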